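(* Let $p,q\in(0,1)$. If $(z_1,z_2)\in\mathbb D^2$ lies in Region 1, then $$g_{\mathbb D^2}((z_1,z_2),(p,0),(0,q))=\log\max\{|z_1m_{z_1}(p)|,\ |z_2m_{z_2}(q)|\}.$$
   Context: $\mathbb D$ is the unit disk in $\mathbb C$, $m_a(\lambda)=\frac{a-\lambda}{1-\overline a\lambda}$ for $a\in\mathbb D$. Green function: for distinct $P,Q\in\mathbb D^2$, $g_{\mathbb D^2}(x,P,Q)$ is the supremum of $f(x)$ over all negative plurisubharmonic $f$ on $\mathbb D^2$ (values in $[-\infty,0)$) with logarithmic poles of weight $1$ at $P$ and $Q$, i.e. $f(y)-\log|y-a|\le O(1)$ as $y\to a$ for $a\in\{P,Q\}$. Region 1 (for fixed $p,q\in(0,1)$) is the set of $(z_1,z_2)\in\mathbb D^2$ such that at least one of the following holds: (i) $|z_2|<|m_{z_1}(p)|$, $|m_{z_2}(q)|<|z_1|$ and $\big|m_{m_{z_2}(q)/z_1}(z_2/m_{z_1}(p))\big|\le p$; (ii) $|m_{z_1}(p)|<|z_2|$, $|z_1|<|m_{z_2}(q)|$ and $\big|m_{z_1/m_{z_2}(q)}(m_{z_1}(p)/z_2)\big|\le q$; (iii) $z_2=\omega m_{z_1}(p)$ and $m_{z_2}(q)=\omega z_1$ for some $|\omega|=1$. *)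

theory Defs
  imports "HOL-Analysis.Analysis"
begin

definition mobius :: "complex \<Rightarrow> complex \<Rightarrow> complex" where
  "mobius a z = (a - z) / (1 - cnj a * z)"

definition bidisk :: "(complex \<times> complex) set" where
  "bidisk = ball 0 1 \<times> ball 0 1"

(* The library's ln satisfies ln 0 = 0; here log 0 is minus infinity. *)
definition elog :: "real \<Rightarrow> ereal" where
  "elog t = (if t \<le> 0 then -\<infinity> else ereal (ln t))"

definition usc_on :: "'a::topological_space set \<Rightarrow> ('a \<Rightarrow> ereal) \<Rightarrow> bool" where
  "usc_on S u \<longleftrightarrow> (\<forall>x\<in>S. \<forall>c. u x < c \<longrightarrow> eventually (\<lambda>y. u y < c) (at x within S))"

(* Mean over the circle, as integral of the positive part minus integral of the
   negative part (e2ennreal sends negative values to 0). For u upper semicontinuous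
   and < \<infinity> on the circle the first integral is finite, so \<infinity> - \<infinity> does not occur. *)
definition circle_mean :: "(complex \<Rightarrow> ereal) \<Rightarrow> complex \<Rightarrow> real \<Rightarrow> ereal" where
  "circle_mean u c r =
     (enn2ereal (\<integral>\<^sup>+ t \<in> {0..2*pi}. e2ennreal (u (c + of_real r * cis t)) \<partial>lborel)
      - enn2ereal (\<integral>\<^sup>+ t \<in> {0..2*pi}. e2ennreal (- u (c + of_real r * cis t)) \<partial>lborel))
     / ereal (2 * pi)"

(* As usual, the constant minus infinity counts as (pluri)subharmonic. *)
definition subharmonic_on :: "complex set \<Rightarrow> (complex \<Rightarrow> ereal) \<Rightarrow> bool" where
  "subharmonic_on U u \<longleftrightarrow> open U \<and> (\<forall>z\<in>U. u z < \<infinity>) \<and> usc_on U u \<and>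
     (\<forall>c r. r > 0 \<longrightarrow> cball c r \<subseteq> U \<longrightarrow> u c \<le> circle_mean u c r)"

definition plurisubharmonic_on ::
    "(complex \<times> complex) set \<Rightarrow> (complex \<times> complex \<Rightarrow> ereal) \<Rightarrow> bool" where
  "plurisubharmonic_on D f \<longleftrightarrow> open D \<and> (\<forall>x\<in>D. f x < \<infinity>) \<and> usc_on D f \<and>
     (\<forall>a1 a2 b1 b2. subharmonic_on {l. (a1 + l * b1, a2 + l * b2) \<in> D}
                      (\<lambda>l. f (a1 + l * b1, a2 + l * b2)))"

(* f(y) - log |y - a| <= O(1) as y tends to a; y = a itself is excluded by the filter. *)
definition log_pole :: "(complex \<times> complex \<Rightarrow> ereal) \<Rightarrow> complex \<times> complex \<Rightarrow> bool" where
  "log_pole f a \<longleftrightarrow> (\<exists>C::real. eventually (\<lambda>y. f y \<le> ereal (ln (norm (y - a)) + C)) (at a))"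

definition green ::
    "complex \<times> complex \<Rightarrow> complex \<times> complex \<Rightarrow> complex \<times> complex \<Rightarrow> ereal" where
  "green x P Q = (SUP f \<in> {f. plurisubharmonic_on bidisk f \<and> (\<forall>y\<in>bidisk. f y < 0) \<and>
                              log_pole f P \<and> log_pole f Q}. f x)"

definition region1 :: "real \<Rightarrow> real \<Rightarrow> (complex \<times> complex) set" where
  "region1 p q = {(z1, z2). (z1, z2) \<in> bidisk \<and>
     ((cmod z2 < cmod (mobius z1 (of_real p)) \<and> cmod (mobius z2 (of_real q)) < cmod z1 \<and>
       cmod (mobius (mobius z2 (of_real q) / z1) (z2 / mobius z1 (of_real p))) \<le> p)
    \<or> (cmod (mobius z1 (of_real p)) < cmod z2 \<and> cmod z1 < cmod (mobius z2 (of_real q)) \<and>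
       cmod (mobius (z1 / mobius z2 (of_real q)) (mobius z1 (of_real p) / z2)) \<le> q)
    \<or> (\<exists>w. cmod w = 1 \<and> z2 = w * mobius z1 (of_real p) \<and> mobius z2 (of_real q) = w * z1))}"

end

theory Submission
  imports Defs "HOL-Complex_Analysis.Complex_Analysis"
begin

text \<open>The lower bound is given by an explicit competitor: \<open>log max {|x m\<^sub>p(x)|, |y m\<^sub>q(y)|}\<close> is negative,
plurisubharmonic and has logarithmic poles at \<open>(p, 0)\<close> and \<open>(0, q)\<close> (lemma \<open>green_ge\<close>). Its submean
inequality on a complex line is a Jensen inequality for a quotient of affine functions.

For the upper bound let \<open>\<psi>\<close> be a holomorphic self-map of the disk with \<open>\<psi> p = 0\<close> and \<open>\<psi> 0 = q\<close>. Its graph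
contains both poles, so a competitor \<open>f\<close> restricted to it is a negative subharmonic function of \<open>x\<close> with
logarithmic poles at \<open>p\<close> and 0, and comparison with the Green function of the disk gives
\<open>f (x, \<psi> x) \<le> log |x m\<^sub>p(x)|\<close> (lemma \<open>two_pole_graph_bound\<close>). Since plurisubharmonic functions are
defined by their restrictions to complex lines, the comparison on a curved disk needs an argument:
lemma \<open>psh_graph_maximum_principle\<close> obtains it from a maximum point of \<open>f\<close> penalised by the
distance to the graph, where the tangent line is a good enough substitute for the disk.

At each point of Region 1 there is such a disk for which this bound, or the same bound with the roles
of the coordinates exchanged, agrees with the competitor. By the Schwarz lemma the condition \<open>\<psi> z1 = z2\<close> means
\<open>\<psi> x = m\<^bsub>z2\<^esub>(m\<^bsub>z1\<^esub>(x) g(x))\<close> with \<open>|g| \<le> 1\<close>, and \<open>\<psi> p = 0\<close>, \<open>\<psi> 0 = q\<close> prescribe \<open>g p = z2 / m\<^bsub>z1\<^esub>(p)\<close> and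
\<open>g 0 = m\<^bsub>z2\<^esub>(q) / z1\<close>. In part (i) both values lie in the disk, and the last inequality of (i) is the Schwarz-Pick
condition that solves this two-point problem; in part (iii) \<open>g\<close> is a unimodular constant; part (ii) is part (i)
after the exchange of the coordinates (lemma \<open>green_swap_le\<close>). In each case the modulus
\<open>|z1 m\<^bsub>z1\<^esub>(p)|\<close> (for (ii), \<open>|z2 m\<^bsub>z2\<^esub>(q)|\<close>) is at most the maximum in the competitor.\<close>

section \<open>Means over circles\<close>
lemma mean_value_holomorphic:
  fixes f :: "complex \<Rightarrow> complex"
  assumes "continuous_on (cball c r) f" "f holomorphic_on ball c r" "0 < r"
  shows "((\<lambda>t. f (c + of_real r * cis t)) has_integral 2 * of_real pi * f c) {0..2*pi}"
proof -
  have "((\<lambda>u. f u / (u - c)) has_contour_integral 2 * of_real pi * \<i> * f c) (part_circlepath c r 0 (2*pi))"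
    using Cauchy_integral_circlepath[OF assms(1,2), of c] assms(3) by (simp add: circlepath_def)
  hence "((\<lambda>t. f (c + r * cis t) / (c + r * cis t - c) * r * \<i> * cis t)
      has_integral 2 * of_real pi * \<i> * f c) {0..2*pi}"
    by (subst (asm) has_contour_integral_part_circlepath_iff) auto
  from has_integral_mult_right[OF this, of "-\<i>"] show ?thesis
    by (rule has_integral_eq_rhs[OF has_integral_eq, rotated]) (use assms(3) in \<open>auto simp: field_simps\<close>)
qed

lemma mean_value_Re:
  fixes f :: "complex \<Rightarrow> complex"
  assumes "continuous_on (cball c r) f" "f holomorphic_on ball c r" "0 < r"
  shows "((\<lambda>t. Re (f (c + of_real r * cis t))) has_integral 2 * pi * Re (f c)) {0..2*pi}"
  using has_integral_Re[OF mean_value_holomorphic[OF assms]] by simp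

lemma mean_value_ln_norm:
  fixes f :: "complex \<Rightarrow> complex"
  assumes f: "f holomorphic_on ball c R" and nz: "\<And>z. z \<in> ball c R \<Longrightarrow> f z \<noteq> 0"
    and r: "0 < r" "r < R"
  shows "((\<lambda>t. ln (cmod (f (c + of_real r * cis t)))) has_integral 2 * pi * ln (cmod (f c))) {0..2*pi}"
proof -
  have "c \<in> ball c R" using r by simp
  from holomorphic_logarithm_exists[OF convex_ball open_ball f nz this]
  obtain g where g: "g holomorphic_on ball c R" "\<And>x. x \<in> ball c R \<Longrightarrow> exp (g x) = f x"
    by auto
  have sub: "cball c r \<subseteq> ball c R" "ball c r \<subseteq> ball c R" using r by auto
  have ln: "ln (cmod (f x)) = Re (g x)" if "x \<in> ball c R" for x
    using g(2)[OF that, symmetric] by simp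
  have "((\<lambda>t. Re (g (c + of_real r * cis t))) has_integral 2 * pi * Re (g c)) {0..2*pi}"
    using g(1) sub r
    by (intro mean_value_Re)
      (auto intro: holomorphic_on_subset holomorphic_on_imp_continuous_on continuous_on_subset)
  moreover have "c + of_real r * cis t \<in> ball c R" for t
    using r by (auto simp: dist_norm norm_mult)
  ultimately show ?thesis using ln r by (simp add: ln)
qed

text \<open>Both integrals in the definition of the mean are monotone in the integrand; since \<open>g\<close> is continuous,
its positive and negative parts have finite integrals, and their difference is \<open>I\<close>.\<close>
lemma circle_mean_le:
  assumes g: "continuous_on {0..2*pi} g" "(g has_integral I) {0..2*pi}"
    and le: "\<And>t. t \<in> {0..2*pi} \<Longrightarrow> u (c + of_real r * cis t) \<le> ereal (g t)"
  shows "circle_mean u c r \<le> ereal (I / (2 * pi))"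
proof -
  \<comment> \<open>The mean is defined through the two parts of the function, so the majorant is split likewise.\<close>
  define gp gm where "gp = (\<lambda>t. max (g t) 0)" and "gm = (\<lambda>t. max (- g t) 0)"
  define a b where "a = integral {0..2*pi} gp" and "b = integral {0..2*pi} gm"
  have "gp integrable_on {0..2*pi}" "gm integrable_on {0..2*pi}"
    unfolding gp_def gm_def using g by (auto intro!: integrable_continuous_interval continuous_intros)
  hence a: "(gp has_integral a) {0..2*pi}" and b: "(gm has_integral b) {0..2*pi}"
    by (auto simp: a_def b_def)
  have "((\<lambda>t. gp t - gm t) has_integral a - b) {0..2*pi}" by (intro has_integral_diff a b)
  moreover have "(\<lambda>t. gp t - gm t) = g" by (auto simp: gp_def gm_def)
  ultimately have I: "I = a - b" using has_integral_unique[OF g(2)] by simp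
  have pos: "a \<ge> 0" "b \<ge> 0"
    using has_integral_nonneg[OF a] has_integral_nonneg[OF b] by (simp_all add: gp_def gm_def)
  have "(\<integral>\<^sup>+ t \<in> {0..2*pi}. e2ennreal (u (c + of_real r * cis t)) \<partial>lborel)
      \<le> (\<integral>\<^sup>+ t \<in> {0..2*pi}. ennreal (gp t) \<partial>lborel)"
  proof (intro nn_integral_mono)
    fix t
    have "e2ennreal (u (c + of_real r * cis t)) \<le> ennreal (gp t)" if "t \<in> {0..2*pi}"
    proof -
      have "u (c + of_real r * cis t) \<le> ereal (gp t)"
        using le[OF that] by (auto simp: gp_def intro: order_trans)
      from e2ennreal_mono[OF this] show ?thesis by simp
    qed
    thus "e2ennreal (u (c + of_real r * cis t)) * indicator {0..2*pi} t
      \<le> ennreal (gp t) * indicator {0..2*pi} t" by (auto simp: indicator_def)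
  qed
  also have "\<dots> = ennreal a"
    by (rule nn_integral_has_integral_lebesgue'[OF _ a]) (auto simp: gp_def)
  finally have 1: "(\<integral>\<^sup>+ t \<in> {0..2*pi}. e2ennreal (u (c + of_real r * cis t)) \<partial>lborel) \<le> ennreal a" .
  have "ennreal b = (\<integral>\<^sup>+ t \<in> {0..2*pi}. ennreal (gm t) \<partial>lborel)"
    by (rule nn_integral_has_integral_lebesgue'[OF _ b, symmetric]) (auto simp: gm_def)
  also have "\<dots> \<le> (\<integral>\<^sup>+ t \<in> {0..2*pi}. e2ennreal (- u (c + of_real r * cis t)) \<partial>lborel)"
  proof (intro nn_integral_mono)
    fix t
    have "ennreal (gm t) \<le> e2ennreal (- u (c + of_real r * cis t))" if "t \<in> {0..2*pi}"
    proof -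
      have "ereal (- g t) \<le> - u (c + of_real r * cis t)"
        using le[OF that] by (metis ereal_minus_le_minus uminus_ereal.simps(1))
      from e2ennreal_mono[OF this] show ?thesis by (simp add: gm_def max_def ennreal_neg)
    qed
    thus "ennreal (gm t) * indicator {0..2*pi} t
       \<le> e2ennreal (- u (c + of_real r * cis t)) * indicator {0..2*pi} t" by (auto simp: indicator_def)
  qed
  finally have 2: "ennreal b \<le> (\<integral>\<^sup>+ t \<in> {0..2*pi}. e2ennreal (- u (c + of_real r * cis t)) \<partial>lborel)" .
  have "enn2ereal (\<integral>\<^sup>+ t \<in> {0..2*pi}. e2ennreal (u (c + of_real r * cis t)) \<partial>lborel)
      - enn2ereal (\<integral>\<^sup>+ t \<in> {0..2*pi}. e2ennreal (- u (c + of_real r * cis t)) \<partial>lborel)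
     \<le> enn2ereal (ennreal a) - enn2ereal (ennreal b)"
    using 1 2 by (intro ereal_minus_mono) (auto simp: less_eq_ennreal.rep_eq)
  also have "\<dots> = ereal I" using pos by (simp add: I)
  finally show ?thesis unfolding circle_mean_def
    using ereal_divide_right_mono[of _ "ereal I" "ereal (2*pi)"] by fastforce
qed

text \<open>The form in which subharmonicity is used throughout: a harmonic majorant on a circle, given as the
real part of a holomorphic function, is a majorant at the centre.\<close>
lemma subharmonic_le_Re:
  assumes u: "subharmonic_on U u" and U: "cball c r \<subseteq> U" "0 < r"
    and H: "continuous_on (cball c r) H" "H holomorphic_on ball c r"
    and le: "\<And>z. z \<in> sphere c r \<Longrightarrow> u z \<le> ereal (Re (H z))"
  shows "u c \<le> ereal (Re (H c))"
proof -
  have in_sphere: "c + of_real r * cis t \<in> sphere c r" for t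
    using U by (auto simp: dist_norm norm_mult)
  have "u c \<le> circle_mean u c r" using u U by (auto simp: subharmonic_on_def)
  also have "\<dots> \<le> ereal (2 * pi * Re (H c) / (2 * pi))"
  proof (rule circle_mean_le)
    have "continuous_on {0..2*pi} (\<lambda>t. H (c + of_real r * cis t))"
      by (rule continuous_on_compose2[OF H(1)])
        (use in_sphere in \<open>auto intro!: continuous_intros\<close>)
    thus "continuous_on {0..2*pi} (\<lambda>t. Re (H (c + of_real r * cis t)))"
      by (intro continuous_intros)
    show "((\<lambda>t. Re (H (c + of_real r * cis t))) has_integral 2 * pi * Re (H c)) {0..2*pi}"
      by (rule mean_value_Re[OF H U(2)])
    show "u (c + of_real r * cis t) \<le> ereal (Re (H (c + of_real r * cis t)))" for t
      by (rule le[OF in_sphere])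
  qed
  finally show ?thesis by simp
qed

section \<open>Jensen inequality for quotients of affine functions\<close>

text \<open>Zeros of \<open>H\<close> on the unit circle make the integrand infinite there. On the circles of radius
\<open>s < 1\<close> the mean value property holds with equality, and letting \<open>s\<close> tend to 1 with
Fatou's lemma leaves the inequality that is needed.\<close>
lemma nn_integral_neg_ln_le:
  assumes H: "continuous_on (cball 0 1) H" "H holomorphic_on ball 0 1"
    and nz: "\<And>z. z \<in> ball 0 1 \<Longrightarrow> H z \<noteq> 0"
    and le1: "\<And>z. z \<in> sphere 0 1 \<Longrightarrow> cmod (H z) \<le> 1"
  shows "(\<integral>\<^sup>+ t \<in> {0..2*pi}. e2ennreal (- elog (cmod (H (cis t)))) \<partial>lborel)
    \<le> ennreal (- (2 * pi * ln (cmod (H 0))))"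
proof -
  define s where "s = (\<lambda>n. 1 - 1 / real (n + 2))"
  have s: "0 < s n" "s n < 1" for n
    using divide_strict_left_mono[of 1 "real (n + 2)" 1] by (simp_all add: s_def)
  have s_lim: "s \<longlonglongrightarrow> 1" unfolding s_def by real_asymp
  have bound: "cmod (H z) \<le> 1" if "z \<in> cball 0 1" for z
    using maximum_modulus_frontier[of H "cball 0 1" 1 z] H le1 that by (auto simp: frontier_cball)
  have s_in: "of_real (s n) * cis t \<in> ball 0 1" for n t
    using s[of n] by (simp add: norm_mult)
  define v where "v = (\<lambda>n t. ennreal (- ln (cmod (H (of_real (s n) * cis t)))) * indicator {0..2*pi} t)"
  have contn: "continuous_on UNIV (\<lambda>t. H (of_real (s n) * cis t))" for n
    by (rule continuous_on_compose2[OF H(1)])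
      (use s_in[of n] in \<open>auto intro!: continuous_intros simp: less_imp_le\<close>)
  have meas: "v n \<in> borel_measurable lborel" for n
  proof -
    have "(\<lambda>t. H (of_real (s n) * cis t)) \<in> borel_measurable borel"
      by (intro borel_measurable_continuous_onI contn)
    thus ?thesis unfolding v_def by measurable
  qed
  have int: "integral\<^sup>N lborel (v n) = ennreal (- (2 * pi * ln (cmod (H 0))))" for n
    unfolding v_def
  proof (rule nn_integral_has_integral_lebesgue')
    show "0 \<le> - ln (cmod (H (complex_of_real (s n) * cis t)))" for t
      using bound[of "of_real (s n) * cis t"] s_in[of n t] nz[OF s_in[of n t]] by (simp add: less_imp_le)
    show "((\<lambda>t. - ln (cmod (H (of_real (s n) * cis t)))) has_integral - (2 * pi * ln (cmod (H 0)))) {0..2*pi}"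
      using mean_value_ln_norm[OF H(2) nz s[of n]] by (intro has_integral_neg) simp
  qed
  have "(\<integral>\<^sup>+ t \<in> {0..2*pi}. e2ennreal (- elog (cmod (H (cis t)))) \<partial>lborel)
    \<le> (\<integral>\<^sup>+ t. liminf (\<lambda>n. v n t) \<partial>lborel)"
  proof (rule nn_integral_mono)
    fix t
    show "e2ennreal (- elog (cmod (H (cis t)))) * indicator {0..2*pi} t \<le> liminf (\<lambda>n. v n t)"
    proof (cases "t \<in> {0..2*pi}")
      case True
      have "(\<lambda>n. of_real (s n) * cis t) \<longlonglongrightarrow> of_real 1 * cis t"
        by (intro tendsto_intros s_lim)
      hence "(\<lambda>n. H (of_real (s n) * cis t)) \<longlonglongrightarrow> H (of_real 1 * cis t)"
        by (rule continuous_on_tendsto_compose[OF H(1)])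
          (use s_in in \<open>auto intro!: always_eventually less_imp_le\<close>)
      hence lim: "(\<lambda>n. cmod (H (of_real (s n) * cis t))) \<longlonglongrightarrow> cmod (H (cis t))"
        by (intro tendsto_intros) auto
      have "(\<lambda>n. ereal (- ln (cmod (H (of_real (s n) * cis t))))) \<longlonglongrightarrow> - elog (cmod (H (cis t)))"
      proof (cases "H (cis t) = 0")
        case True
        have "filterlim (\<lambda>n. cmod (H (of_real (s n) * cis t))) (at_right 0) sequentially"
          using lim True nz[OF s_in] by (auto simp: filterlim_at)
        from filterlim_compose[OF ln_at_0 this]
        have "filterlim (\<lambda>n. - ln (cmod (H (of_real (s n) * cis t)))) at_top sequentially"
          by (simp add: filterlim_uminus_at_top)
        thus ?thesis using True by (simp add: elog_def tendsto_PInfty_eq_at_top)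
      next
        case False
        thus ?thesis using lim by (auto simp: elog_def intro!: tendsto_intros)
      qed
      hence "(\<lambda>n. e2ennreal (ereal (- ln (cmod (H (of_real (s n) * cis t)))))) \<longlonglongrightarrow> e2ennreal (- elog (cmod (H (cis t))))"
        by (rule tendsto_e2ennrealI)
      hence "(\<lambda>n. v n t) \<longlonglongrightarrow> e2ennreal (- elog (cmod (H (cis t))))"
        using True by (simp add: v_def)
      thus ?thesis using True by (simp add: lim_imp_Liminf)
    qed auto
  qed
  also have "\<dots> \<le> liminf (\<lambda>n. integral\<^sup>N lborel (v n))"
    by (rule nn_integral_liminf) (rule meas)
  also have "\<dots> = ennreal (- (2 * pi * ln (cmod (H 0))))" by (simp add: int Liminf_const)
  finally show ?thesis .
qed

text \<open>If the zero of \<open>a + b z\<close> lies in the open disk, then \<open>cnj b + cnj a z\<close> has the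
reflected zero and the same modulus on the unit circle, and its modulus at 0 is larger.\<close>
lemma affine_reflect_zero:
  fixes a b :: complex
  assumes "a \<noteq> 0"
  obtains a' b' where "cmod a \<le> cmod a'"
    "\<And>z. cmod z = 1 \<Longrightarrow> cmod (a' + b' * z) = cmod (a + b * z)"
    "\<And>z. cmod z < 1 \<Longrightarrow> a' + b' * z \<noteq> 0"
proof -
  have nz: "a' + b' * z \<noteq> 0" if "cmod b' \<le> cmod a'" "a' \<noteq> 0" "cmod z < 1" for a' b' z :: complex
  proof
    assume "a' + b' * z = 0"
    hence eq: "cmod a' = cmod b' * cmod z"
      by (metis add_eq_0_iff2 norm_minus_cancel norm_mult)
    with that(2) have "0 < cmod b'" by auto
    hence "cmod b' * cmod z < cmod b'" using that(3) by simp
    with eq that(1) show False by simp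
  qed
  show thesis
  proof (cases "cmod b \<le> cmod a")
    case True
    show thesis by (rule that[of a b]) (use nz True assms in auto)
  next
    case False
    have "cmod (cnj b + cnj a * z) = cmod (a + b * z)" if "cmod z = 1" for z
    proof -
      have "cmod (cnj b + cnj a * z) = cmod (cnj (cnj b + cnj a * z))" by (simp only: complex_mod_cnj)
      also have "\<dots> = cmod (z * (b + a * cnj z))" using that by (simp add: norm_mult)
      also have "z * (b + a * cnj z) = a * (z * cnj z) + b * z" by (simp add: algebra_simps)
      also have "z * cnj z = 1" using that by (simp add: complex_norm_square[symmetric])
      finally show ?thesis by simp
    qed
    thus thesis by (intro that[of "cnj b" "cnj a"] nz) (use False in auto)
  qed
qed

text \<open>The Jensen inequality for a function with at most two zeros: reflecting them out of the disk
changes nothing on the circle and only raises the value at the centre.\<close>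
lemma nn_integral_neg_ln_le_two_zeros:
  fixes a b c d :: complex and e :: "complex \<Rightarrow> complex"
  defines "F \<equiv> (\<lambda>z. (a + b * z) * (c + d * z) / e z)"
  assumes e: "continuous_on (cball 0 1) e" "e holomorphic_on ball 0 1"
    and nz: "\<And>z. z \<in> cball 0 1 \<Longrightarrow> e z \<noteq> 0"
    and le1: "\<And>z. z \<in> sphere 0 1 \<Longrightarrow> cmod (F z) \<le> 1"
    and F0: "F 0 \<noteq> 0"
  shows "(\<integral>\<^sup>+ t \<in> {0..2*pi}. e2ennreal (- elog (cmod (F (cis t)))) \<partial>lborel)
    \<le> ennreal (- (2 * pi * ln (cmod (F 0))))"
proof -
  have "a \<noteq> 0" "c \<noteq> 0" using F0 by (auto simp: F_def)
  from affine_reflect_zero[OF this(1), of b] affine_reflect_zero[OF this(2), of d]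
  obtain a' b' c' d' where
    A: "cmod a \<le> cmod a'" "\<And>z. cmod z = 1 \<Longrightarrow> cmod (a' + b' * z) = cmod (a + b * z)"
    "\<And>z. cmod z < 1 \<Longrightarrow> a' + b' * z \<noteq> 0" and
    C: "cmod c \<le> cmod c'" "\<And>z. cmod z = 1 \<Longrightarrow> cmod (c' + d' * z) = cmod (c + d * z)"
    "\<And>z. cmod z < 1 \<Longrightarrow> c' + d' * z \<noteq> 0" by metis
  define H where "H = (\<lambda>z. (a' + b' * z) * (c' + d' * z) / e z)"
  have eq: "cmod (H z) = cmod (F z)" if "cmod z = 1" for z
    using that A(2) C(2) by (simp add: H_def F_def norm_mult norm_divide)
  have e0: "e 0 \<noteq> 0" using nz by simp
  have "cmod (F 0) \<le> cmod (H 0)"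
    using A(1) C(1) e0 by (auto simp: H_def F_def norm_mult norm_divide intro!: divide_right_mono mult_mono)
  hence ln_le: "ln (cmod (F 0)) \<le> ln (cmod (H 0))" using F0
    by (intro ln_mono) auto
  have "(\<integral>\<^sup>+ t \<in> {0..2*pi}. e2ennreal (- elog (cmod (H (cis t)))) \<partial>lborel)
    \<le> ennreal (- (2 * pi * ln (cmod (H 0))))"
  proof (rule nn_integral_neg_ln_le)
    show "continuous_on (cball 0 1) H" unfolding H_def
      by (intro continuous_intros e) (use nz in auto)
    show "H holomorphic_on ball 0 1" unfolding H_def
      by (intro holomorphic_intros e) (use nz in auto)
    show "H z \<noteq> 0" if "z \<in> ball 0 1" for z
      using that A(3) C(3) nz by (auto simp: H_def)
    show "cmod (H z) \<le> 1" if "z \<in> sphere 0 1" for z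
      using that eq le1 by auto
  qed
  also have "\<dots> \<le> ennreal (- (2 * pi * ln (cmod (F 0))))"
    using ln_le by (intro ennreal_leI) simp
  finally show ?thesis by (simp add: eq)
qed

section \<open>Disk automorphisms\<close>
lemma cmod_mobius_commute: "cmod (mobius a b) = cmod (mobius b a)"
proof -
  have "cmod (1 - cnj a * b) = cmod (cnj (1 - cnj a * b))" by (simp only: complex_mod_cnj)
  also have "\<dots> = cmod (1 - cnj b * a)" by (simp add: mult.commute)
  finally show ?thesis by (simp add: mobius_def norm_divide norm_minus_commute)
qed

lemma mobius_denom_nz: "cmod a < 1 \<Longrightarrow> cmod z \<le> 1 \<Longrightarrow> 1 - cnj a * z \<noteq> 0"
proof
  assume *: "cmod a < 1" "cmod z \<le> 1" "1 - cnj a * z = 0"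
  hence "cmod (cnj a * z) = 1" by simp
  hence "cmod a * cmod z = 1" by (simp add: norm_mult)
  moreover have "cmod a * cmod z \<le> cmod a * 1" using * by (intro mult_left_mono) auto
  ultimately show False using *(1) by simp
qed

lemma one_minus_mobius_norm:
  assumes "1 - cnj a * z \<noteq> 0"
  shows "1 - (cmod (mobius a z))\<^sup>2 = (1 - (cmod a)\<^sup>2) * (1 - (cmod z)\<^sup>2) / (cmod (1 - cnj a * z))\<^sup>2"
proof -
  have eq: "(cmod (1 - cnj a * z))\<^sup>2 - (cmod (a - z))\<^sup>2 = (1 - (cmod a)\<^sup>2) * (1 - (cmod z)\<^sup>2)"
    unfolding cmod_power2 by (simp add: power2_eq_square algebra_simps)
  have "(cmod (1 - cnj a * z))\<^sup>2 \<noteq> 0" using assms by simp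
  thus ?thesis unfolding mobius_def norm_divide power_divide eq[symmetric]
    by (simp add: field_simps)
qed

lemma mobius_norm_less_1:
  assumes "cmod a < 1" "cmod z < 1" shows "cmod (mobius a z) < 1"
proof -
  have "1 - cnj a * z \<noteq> 0" using mobius_denom_nz assms by simp
  moreover have "(cmod a)\<^sup>2 < 1" "(cmod z)\<^sup>2 < 1" using assms by (auto simp: power_less_one_iff)
  ultimately have "1 - (cmod (mobius a z))\<^sup>2 > 0"
    by (subst one_minus_mobius_norm) auto
  thus ?thesis by (simp add: power_less_one_iff)
qed

lemma mobius_norm_eq_1:
  assumes "cmod a < 1" "cmod z = 1" shows "cmod (mobius a z) = 1"
proof -
  have "1 - cnj a * z \<noteq> 0" using mobius_denom_nz assms by simp
  from one_minus_mobius_norm[OF this] have "(cmod (mobius a z))\<^sup>2 = 1\<^sup>2" using assms by simp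
  thus ?thesis by (subst (asm) power2_eq_iff_nonneg) auto
qed

lemma mobius_mobius:
  assumes "cmod a < 1" "cmod z < 1" shows "mobius a (mobius a z) = z"
proof -
  have 1: "1 - cnj a * z \<noteq> 0" "1 - cnj a * a \<noteq> 0" using mobius_denom_nz assms by simp_all
  have n: "a - mobius a z = z * (1 - cnj a * a) / (1 - cnj a * z)"
    using 1(1) by (simp add: mobius_def field_simps)
  have d: "1 - cnj a * mobius a z = (1 - cnj a * a) / (1 - cnj a * z)"
    using 1(1) by (simp add: mobius_def field_simps)
  show ?thesis unfolding mobius_def[of a "mobius a z"] n d using 1 by simp
qed

lemma mobius_holomorphic_on:
  assumes "cmod a < 1" shows "mobius a holomorphic_on ball 0 1"
  unfolding mobius_def[abs_def]
  by (intro holomorphic_intros) (use mobius_denom_nz assms in auto)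

section \<open>The explicit competitor\<close>
lemma usc_on_elog:
  assumes M: "continuous_on S M"
  shows "usc_on S (\<lambda>x. elog (M x))"
  unfolding usc_on_def
proof (intro ballI allI impI)
  fix x c assume x: "x \<in> S" and c: "elog (M x) < c"
  have iff: "elog t < ereal c \<longleftrightarrow> t < exp c" for t c
  proof (cases "t \<le> 0")
    case True
    hence "t < exp c" using exp_gt_zero le_less_trans by blast
    thus ?thesis using True by (simp add: elog_def)
  next
    case False
    hence "ln t < c \<longleftrightarrow> t < exp c" by (metis exp_less_cancel_iff exp_ln not_le)
    thus ?thesis using False by (simp add: elog_def)
  qed
  show "eventually (\<lambda>y. elog (M y) < c) (at x within S)"
  proof (cases c)
    case (real c')
    have "(M \<longlongrightarrow> M x) (at x within S)" using M x by (auto simp: continuous_on_def)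
    from order_tendstoD(2)[OF this, of "exp c'"] c show ?thesis by (simp add: real iff)
  qed (use c in \<open>auto simp: elog_def\<close>)
qed

text \<open>For a nonpositive function the positive part drops out, and a lower bound for the mean becomes an
upper bound for one nonnegative integral, to which Fatou's lemma applies.\<close>
lemma circle_mean_ge:
  assumes neg: "\<And>t. t \<in> {0..2*pi} \<Longrightarrow> u (c + of_real r * cis t) \<le> 0"
    and J: "(\<integral>\<^sup>+ t \<in> {0..2*pi}. e2ennreal (- u (c + of_real r * cis t)) \<partial>lborel) \<le> ennreal (- (2 * pi * m))"
    and m: "m \<le> 0"
  shows "ereal m \<le> circle_mean u c r"
proof -
  have z: "(\<integral>\<^sup>+ t \<in> {0..2*pi}. e2ennreal (u (c + of_real r * cis t)) \<partial>lborel) = 0"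
  proof -
    have "e2ennreal (u (c + of_real r * cis t)) * indicator {0..2*pi} t = 0" for t
      using neg[of t] by (auto simp: indicator_def e2ennreal_neg)
    thus ?thesis by (simp only: nn_integral_const) simp
  qed
  obtain j where j: "(\<integral>\<^sup>+ t \<in> {0..2*pi}. e2ennreal (- u (c + of_real r * cis t)) \<partial>lborel) = ennreal j" "j \<ge> 0"
    using le_less_trans[OF J ennreal_less_top] by (auto simp: less_top_ennreal)
  have "2 * pi * m \<le> 0" using m by (simp add: mult_nonneg_nonpos)
  hence "j \<le> - (2 * pi * m)" using J j(1) by (simp add: ennreal_le_iff)
  hence "m \<le> - j / (2 * pi)" by (simp add: field_simps)
  thus ?thesis unfolding circle_mean_def z j(1) using j(2) by (simp add: zero_ennreal.rep_eq)
qed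

lemma cmod_mobius_real: "cmod (mobius x (of_real p)) = cmod ((of_real p - x) / (1 - of_real p * x))"
  by (subst cmod_mobius_commute) (simp add: mobius_def)

lemma norm_mult_mobius_less_1:
  assumes "cmod x < 1" "\<bar>p\<bar> < 1"
  shows "cmod (x * mobius x (of_real p)) < 1"
proof -
  have "cmod (mobius x (of_real p)) < 1" using assms by (intro mobius_norm_less_1) auto
  hence "cmod x * cmod (mobius x (of_real p)) \<le> cmod x * 1" by (intro mult_left_mono) auto
  thus ?thesis using assms(1) by (simp add: norm_mult)
qed

text \<open>On a complex line the two-pole Blaschke product is a quotient of affine functions whose
denominator has no zero, so that the two-zero Jensen inequality applies after rescaling the circle
to the unit circle.\<close>
lemma submean_two_pole_blaschke:
  fixes p :: real
  defines "B \<equiv> (\<lambda>x. cmod (x * mobius x (of_real p)))"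
  assumes p: "\<bar>p\<bar> < 1" and r: "0 < r"
    and sub: "\<And>l. l \<in> cball c r \<Longrightarrow> cmod (a + l * b) < 1"
    and nz: "B (a + c * b) \<noteq> 0"
  shows "(\<integral>\<^sup>+ t \<in> {0..2*pi}. e2ennreal (- elog (B (a + (c + of_real r * cis t) * b))) \<partial>lborel)
    \<le> ennreal (- (2 * pi * ln (B (a + c * b))))"
proof -
  define A D where "A = a + c * b" and "D = of_real r * b"
  have in1: "cmod (A + D * z) < 1" if "z \<in> cball 0 1" for z
  proof -
    have "c + of_real r * z \<in> cball c r"
      using that r by (simp add: dist_norm norm_mult mult_left_le)
    from sub[OF this] show ?thesis by (simp add: A_def D_def algebra_simps)
  qed
  \<comment> \<open>The circle of radius r around c, written as an affine image of the unit circle.\<close>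
  define F where "F = (\<lambda>z. (A + D * z) * ((of_real p - A) + (- D) * z) / (1 - of_real p * (A + D * z)))"
  have BF: "B (A + D * z) = cmod (F z)" for z
  proof -
    have "(of_real p - A) + (- D) * z = of_real p - (A + D * z)" by simp
    thus ?thesis by (simp only: B_def F_def norm_mult cmod_mobius_real norm_divide times_divide_eq_right)
  qed
  have "1 - of_real p * (A + D * z) \<noteq> 0" if "z \<in> cball 0 1" for z
    using mobius_denom_nz[of "of_real p" "A + D * z"] in1[OF that] p by simp
  moreover have "cmod (F z) \<le> 1" if "z \<in> sphere 0 1" for z
    using norm_mult_mobius_less_1[OF in1 p, of z] that by (simp add: BF[symmetric]) (simp add: B_def)
  moreover have "F 0 \<noteq> 0" using nz BF[of 0] by (simp add: A_def)
  ultimately have "(\<integral>\<^sup>+ t \<in> {0..2*pi}. e2ennreal (- elog (cmod (F (cis t)))) \<partial>lborel)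
      \<le> ennreal (- (2 * pi * ln (cmod (F 0))))"
    unfolding F_def by (intro nn_integral_neg_ln_le_two_zeros continuous_intros holomorphic_intros) auto
  moreover have "a + (c + of_real r * cis t) * b = A + D * cis t" for t
    by (simp add: A_def D_def algebra_simps)
  moreover have "a + c * b = A + D * 0" by (simp add: A_def)
  ultimately show ?thesis by (simp only: BF)
qed

definition pole_modulus :: "real \<Rightarrow> real \<Rightarrow> complex \<times> complex \<Rightarrow> real" where
  "pole_modulus p q z =
     max (cmod (fst z * mobius (fst z) (of_real p))) (cmod (snd z * mobius (snd z) (of_real q)))"

lemma open_bidisk: "open bidisk"
  unfolding bidisk_def by (intro open_Times open_ball)

lemma elog_mono: "s \<le> t \<Longrightarrow> elog s \<le> elog t"
  by (auto simp: elog_def)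

lemma elog_neg: "t < 1 \<Longrightarrow> elog t < 0"
  by (auto simp: elog_def)

lemma continuous_on_mult_mobius:
  assumes "\<bar>p\<bar> < 1"
  shows "continuous_on (ball 0 1) (\<lambda>x. cmod (x * mobius x (of_real p)))"
  unfolding norm_mult cmod_mobius_real
  by (intro continuous_intros) (use mobius_denom_nz[of "of_real p"] assms in auto)

lemma continuous_on_pole_modulus:
  assumes "\<bar>p\<bar> < 1" "\<bar>q\<bar> < 1"
  shows "continuous_on bidisk (pole_modulus p q)"
  unfolding pole_modulus_def[abs_def]
  by (intro continuous_intros
      continuous_on_compose2[OF continuous_on_mult_mobius[OF assms(1)], of _ fst]
      continuous_on_compose2[OF continuous_on_mult_mobius[OF assms(2)], of _ snd])
    (auto simp: bidisk_def)

lemma pole_modulus_less_1: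
  "\<bar>p\<bar> < 1 \<Longrightarrow> \<bar>q\<bar> < 1 \<Longrightarrow> z \<in> bidisk \<Longrightarrow> pole_modulus p q z < 1"
  by (auto simp: pole_modulus_def bidisk_def norm_mult_mobius_less_1)

text \<open>The submean inequality at a point only has to be checked for the coordinate that attains the
maximum there, since the maximum dominates that coordinate everywhere.\<close>
lemma plurisubharmonic_pole_modulus:
  assumes pq: "\<bar>p\<bar> < 1" "\<bar>q\<bar> < 1"
  shows "plurisubharmonic_on bidisk (\<lambda>z. elog (pole_modulus p q z))"
  unfolding plurisubharmonic_on_def
proof (intro conjI allI ballI)
  show "open bidisk" by (rule open_bidisk)
  show "elog (pole_modulus p q z) < \<infinity>" for z by (simp add: elog_def)
  show "usc_on bidisk (\<lambda>z. elog (pole_modulus p q z))"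
    by (intro usc_on_elog continuous_on_pole_modulus pq)
  fix a1 a2 b1 b2 :: complex
  define \<phi> where "\<phi> = (\<lambda>l. (a1 + l * b1, a2 + l * b2))"
  define U where "U = {l. \<phi> l \<in> bidisk}"
  have cont: "continuous_on A \<phi>" for A unfolding \<phi>_def by (intro continuous_intros)
  have "subharmonic_on U (\<lambda>l. elog (pole_modulus p q (\<phi> l)))"
    unfolding subharmonic_on_def
  proof (intro conjI allI ballI impI)
    show "open U" unfolding U_def using open_vimage[OF open_bidisk cont] by (simp add: vimage_def)
    show "elog (pole_modulus p q (\<phi> l)) < \<infinity>" for l by (simp add: elog_def)
    show "usc_on U (\<lambda>l. elog (pole_modulus p q (\<phi> l)))"
      by (intro usc_on_elog continuous_on_compose2[OF continuous_on_pole_modulus[OF pq] cont])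
        (auto simp: U_def)
    fix c r assume r: "(r::real) > 0" and sub: "cball c r \<subseteq> U"
    have neg: "elog (pole_modulus p q (\<phi> l)) < 0" if "l \<in> cball c r" for l
      by (intro elog_neg pole_modulus_less_1[OF pq]) (use that sub in \<open>auto simp: U_def\<close>)
    show "elog (pole_modulus p q (\<phi> c)) \<le> circle_mean (\<lambda>l. elog (pole_modulus p q (\<phi> l))) c r"
    proof (cases "pole_modulus p q (\<phi> c) > 0")
      case False
      thus ?thesis by (simp add: elog_def)
    next
      case True
      have on_circle: "c + of_real r * cis t \<in> cball c r" for t
        using r by (simp add: dist_norm norm_mult)
      obtain a b s where s: "\<bar>s\<bar> < 1" "\<And>l. l \<in> cball c r \<Longrightarrow> cmod (a + l * b) < 1"
        and eq: "pole_modulus p q (\<phi> c) = cmod ((a + c * b) * mobius (a + c * b) (of_real s))"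
        and ge: "\<And>l. cmod ((a + l * b) * mobius (a + l * b) (of_real s)) \<le> pole_modulus p q (\<phi> l)"
      proof (cases "cmod (fst (\<phi> c) * mobius (fst (\<phi> c)) (of_real p)) \<ge> cmod (snd (\<phi> c) * mobius (snd (\<phi> c)) (of_real q))")
        case True
        thus thesis using sub pq by (intro that[of p a1 b1])
            (auto simp: pole_modulus_def \<phi>_def U_def bidisk_def subset_iff)
      next
        case False
        thus thesis using sub pq by (intro that[of q a2 b2])
            (auto simp: pole_modulus_def \<phi>_def U_def bidisk_def subset_iff)
      qed
      have "ereal (ln (pole_modulus p q (\<phi> c))) \<le> circle_mean (\<lambda>l. elog (pole_modulus p q (\<phi> l))) c r"
      proof (rule circle_mean_ge)
        show "elog (pole_modulus p q (\<phi> (c + of_real r * cis t))) \<le> 0" for t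
          using neg[OF on_circle] by (rule less_imp_le)
        show "ln (pole_modulus p q (\<phi> c)) \<le> 0"
          using neg[of c] r True by (simp add: elog_def)
        have "(\<integral>\<^sup>+ t \<in> {0..2*pi}. e2ennreal (- elog (pole_modulus p q (\<phi> (c + of_real r * cis t)))) \<partial>lborel)
          \<le> (\<integral>\<^sup>+ t \<in> {0..2*pi}. e2ennreal (- elog (cmod ((a + (c + of_real r * cis t) * b) *
               mobius (a + (c + of_real r * cis t) * b) (of_real s)))) \<partial>lborel)"
          by (intro nn_integral_mono mult_right_mono e2ennreal_mono)
            (auto simp: ereal_minus_le_minus intro!: elog_mono ge)
        also have "\<dots> \<le> ennreal (- (2 * pi * ln (pole_modulus p q (\<phi> c))))"
          unfolding eq by (rule submean_two_pole_blaschke) (use s r True eq in auto)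
        finally show "(\<integral>\<^sup>+ t \<in> {0..2*pi}. e2ennreal (- elog (pole_modulus p q (\<phi> (c + of_real r * cis t)))) \<partial>lborel)
          \<le> ennreal (- (2 * pi * ln (pole_modulus p q (\<phi> c))))" .
      qed
      thus ?thesis using True by (simp add: elog_def)
    qed
  qed
  thus "subharmonic_on {l. (a1 + l * b1, a2 + l * b2) \<in> bidisk}
          (\<lambda>l. elog (pole_modulus p q (a1 + l * b1, a2 + l * b2)))"
    by (simp add: U_def \<phi>_def)
qed

lemma norm_mult_mobius_le:
  assumes "cmod x < 1" "\<bar>p\<bar> < 1"
  shows "cmod (x * mobius x (of_real p)) \<le> cmod (x - of_real p) / (1 - \<bar>p\<bar>)"
    and "cmod (x * mobius x (of_real p)) \<le> cmod x / (1 - \<bar>p\<bar>)"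
proof -
  have d: "1 - \<bar>p\<bar> > 0" using assms by simp
  have "cmod (of_real p * x) \<le> \<bar>p\<bar> * 1"
    using assms(1) unfolding norm_mult by (intro mult_mono) auto
  hence "1 - \<bar>p\<bar> \<le> cmod (1 - of_real p * x)"
    using norm_triangle_ineq2[of 1 "of_real p * x"] by simp
  hence "cmod (x - of_real p) / cmod (1 - of_real p * x) \<le> cmod (x - of_real p) / (1 - \<bar>p\<bar>)"
    using d by (intro divide_left_mono mult_pos_pos) (linarith | simp)+
  moreover have "cmod x * (cmod (x - of_real p) / cmod (1 - of_real p * x))
      \<le> 1 * (cmod (x - of_real p) / cmod (1 - of_real p * x))"
    using assms by (intro mult_right_mono) auto
  ultimately show "cmod (x * mobius x (of_real p)) \<le> cmod (x - of_real p) / (1 - \<bar>p\<bar>)"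
    by (simp add: norm_mult cmod_mobius_real norm_divide norm_minus_commute)
  have "cmod x * cmod (mobius x (of_real p)) \<le> cmod x * 1"
    using mobius_norm_less_1[of x "of_real p"] assms by (intro mult_left_mono) auto
  also have "cmod x * (1 - \<bar>p\<bar>) \<le> cmod x * 1" by (intro mult_left_mono) auto
  hence "cmod x * 1 \<le> cmod x / (1 - \<bar>p\<bar>)" using d by (simp add: field_simps)
  finally show "cmod (x * mobius x (of_real p)) \<le> cmod x / (1 - \<bar>p\<bar>)" by (simp add: norm_mult)
qed

lemma log_pole_pole_modulus:
  assumes pq: "\<bar>p\<bar> < 1" "\<bar>q\<bar> < 1" and a: "a = (of_real p, 0) \<or> a = (0, of_real q)"
  shows "log_pole (\<lambda>z. elog (pole_modulus p q z)) a"
proof -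
  define C where "C = 1 / ((1 - \<bar>p\<bar>) * (1 - \<bar>q\<bar>))"
  have pos: "0 < 1 - \<bar>p\<bar>" "0 < 1 - \<bar>q\<bar>" using pq by auto
  hence C: "C > 0" by (simp add: C_def)
  have "1 / (1 - \<bar>p\<bar>) \<le> C" "1 / (1 - \<bar>q\<bar>) \<le> C"
    unfolding C_def using pos by (auto intro!: divide_left_mono simp: mult_left_le mult_left_le_one_le)
  hence Cle: "n / (1 - \<bar>p\<bar>) \<le> C * n'" "n / (1 - \<bar>q\<bar>) \<le> C * n'" if "0 \<le> n" "n \<le> n'" for n n'
    using that C mult_mono[of "1 / (1 - \<bar>p\<bar>)" C n n'] mult_mono[of "1 / (1 - \<bar>q\<bar>)" C n n'] by auto
  have le: "pole_modulus p q z \<le> C * norm (z - a)" if "z \<in> bidisk" for z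
  proof -
    obtain x y where z: "z = (x, y)" by fastforce
    have xy: "cmod x < 1" "cmod y < 1" using that by (auto simp: z bidisk_def)
    note n = norm_mult_mobius_le[OF xy(1) pq(1)] norm_mult_mobius_le[OF xy(2) pq(2)]
    have fs: "cmod (fst (z - a)) \<le> norm (z - a)" "cmod (snd (z - a)) \<le> norm (z - a)"
      by (metis norm_fst_le surjective_pairing) (metis norm_snd_le surjective_pairing)
    show ?thesis using a
    proof
      assume a: "a = (of_real p, 0)"
      show ?thesis using order_trans[OF n(1) Cle(1)[of _ "norm (z - a)"]] order_trans[OF n(4) Cle(2)[of _ "norm (z - a)"]] fs
        by (simp add: pole_modulus_def z a)
    next
      assume a: "a = (0, of_real q)"
      show ?thesis using order_trans[OF n(2) Cle(1)[of _ "norm (z - a)"]] order_trans[OF n(3) Cle(2)[of _ "norm (z - a)"]] fs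
        by (simp add: pole_modulus_def z a)
    qed
  qed
  have "a \<in> bidisk" using a pq by (auto simp: bidisk_def)
  hence "eventually (\<lambda>z. z \<in> bidisk) (at a)"
    using open_bidisk by (intro eventually_at_in_open') auto
  hence "eventually (\<lambda>z. elog (pole_modulus p q z) \<le> ereal (ln (norm (z - a)) + ln C)) (at a)"
    using eventually_neq_at_within[of a]
  proof eventually_elim
    case (elim z)
    have "elog (pole_modulus p q z) \<le> elog (C * norm (z - a))" by (intro elog_mono le elim)
    also have "\<dots> = ereal (ln (norm (z - a)) + ln C)"
      using elim C by (simp add: elog_def mult_le_0_iff ln_mult)
    finally show ?case .
  qed
  thus ?thesis unfolding log_pole_def by blast
qed

lemma green_ge:
  assumes "\<bar>p\<bar> < 1" "\<bar>q\<bar> < 1"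
  shows "elog (pole_modulus p q z) \<le> green z (of_real p, 0) (0, of_real q)"
  unfolding green_def
  by (rule SUP_upper2[where i = "\<lambda>z. elog (pole_modulus p q z)"])
    (use assms plurisubharmonic_pole_modulus log_pole_pole_modulus pole_modulus_less_1 elog_neg in auto)

section \<open>Upper semicontinuous functions\<close>
lemma usc_on_subset: "usc_on S u \<Longrightarrow> T \<subseteq> S \<Longrightarrow> usc_on T u"
  unfolding usc_on_def by (auto intro: filter_leD[OF at_le])

lemma usc_on_compose:
  assumes u: "usc_on T u" and g: "continuous_on S g" "g ` S \<subseteq> T"
  shows "usc_on S (\<lambda>x. u (g x))"
  unfolding usc_on_def
proof (intro ballI allI impI)
  fix x c assume x: "x \<in> S" and c: "u (g x) < c"
  hence gx: "g x \<in> T" using g by auto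
  with u c have "eventually (\<lambda>y. u y < c) (at (g x) within T)" by (auto simp: usc_on_def)
  then obtain W where W: "open W" "g x \<in> W" "\<And>y. y \<in> W \<Longrightarrow> y \<in> T \<Longrightarrow> u y < c"
    unfolding eventually_at_topological using c by metis
  have "(g \<longlongrightarrow> g x) (at x within S)" using g(1) x by (auto simp: continuous_on_def)
  from topological_tendstoD[OF this W(1,2)]
  have "eventually (\<lambda>y. g y \<in> W) (at x within S)" .
  moreover have "eventually (\<lambda>y. y \<in> S) (at x within S)" by (simp add: eventually_at_filter)
  ultimately show "eventually (\<lambda>y. u (g y) < c) (at x within S)"
    by eventually_elim (use W(3) g(2) in auto)
qed

lemma usc_on_add_continuous:
  fixes g :: "'a::topological_space \<Rightarrow> real"
  assumes u: "usc_on S u" and g: "continuous_on S g"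
  shows "usc_on S (\<lambda>x. u x + ereal (g x))"
  unfolding usc_on_def
proof (intro ballI allI impI)
  fix x c assume x: "x \<in> S" and c: "u x + ereal (g x) < c"
  hence "u x < c - ereal (g x)" by (simp add: ereal_less_minus)
  then obtain a where a: "u x < ereal a" "ereal a < c - ereal (g x)" using ereal_dense2 by blast
  from u x a(1) have ev: "eventually (\<lambda>y. u y < ereal a) (at x within S)" by (auto simp: usc_on_def)
  show "eventually (\<lambda>y. u y + ereal (g y) < c) (at x within S)"
  proof (cases c)
    case (real b)
    have "(g \<longlongrightarrow> g x) (at x within S)" using g x by (auto simp: continuous_on_def)
    from order_tendstoD(2)[OF this, of "b - a"] a(2)
    have "eventually (\<lambda>y. g y < b - a) (at x within S)" by (simp add: real)
    with ev show ?thesis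
    proof eventually_elim
      case (elim y)
      thus ?case by (cases "u y") (auto simp: real)
    qed
  next
    case PInf
    from ev show ?thesis
    proof eventually_elim
      case (elim y)
      thus ?case by (cases "u y") (auto simp: PInf)
    qed
  qed (use c in auto)
qed

lemma usc_on_attains_max:
  assumes S: "compact S" "S \<noteq> {}" and u: "usc_on S u"
  obtains x where "x \<in> S" "\<And>y. y \<in> S \<Longrightarrow> u y \<le> u x"
proof (rule ccontr)
  assume "\<not> thesis"
  hence "\<forall>x\<in>S. \<exists>y\<in>S. u x < u y" using that by (meson not_le)
  then obtain m where m: "\<And>x. x \<in> S \<Longrightarrow> m x \<in> S" "\<And>x. x \<in> S \<Longrightarrow> u x < u (m x)" by metis
  have "\<exists>W. open W \<and> x \<in> W \<and> (\<forall>z\<in>W \<inter> S. u z < u (m x))" if "x \<in> S" for x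
  proof -
    have "eventually (\<lambda>z. u z < u (m x)) (at x within S)"
      using u that m(2)[OF that] by (auto simp: usc_on_def)
    thus ?thesis unfolding eventually_at_topological using m(2)[OF that] by (metis IntD1 IntD2)
  qed
  then obtain W where W: "\<And>x. x \<in> S \<Longrightarrow> open (W x)" "\<And>x. x \<in> S \<Longrightarrow> x \<in> W x"
    "\<And>x z. x \<in> S \<Longrightarrow> z \<in> W x \<Longrightarrow> z \<in> S \<Longrightarrow> u z < u (m x)" by (metis IntI)
  obtain C where C: "C \<subseteq> S" "finite C" "S \<subseteq> (\<Union>x\<in>C. W x)"
    by (rule compactE_image[OF S(1), of S W]) (use W in auto)
  have "C \<noteq> {}" using C(3) S(2) by auto
  define M where "M = Max ((\<lambda>x. u (m x)) ` C)"
  have "M \<in> (\<lambda>x. u (m x)) ` C" unfolding M_def by (rule Max_in) (use C \<open>C \<noteq> {}\<close> in auto)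
  then obtain x where x: "x \<in> C" "M = u (m x)" by auto
  obtain x' where x': "x' \<in> C" "m x \<in> W x'" using C m(1)[of x] x(1) by blast
  have "M < u (m x')" using W(3)[of x' "m x"] x' x C(1) m(1) by auto
  also have "\<dots> \<le> M" unfolding M_def by (rule Max_ge) (use C x' in auto)
  finally show False by simp
qed

lemma usc_on_less_open:
  fixes g :: "'a::topological_space \<Rightarrow> real"
  assumes u: "usc_on S u" and S: "open S" and g: "continuous_on S g"
  shows "open {x\<in>S. u x < ereal (g x)}"
proof (subst open_subopen, intro ballI)
  fix x assume "x \<in> {x\<in>S. u x < ereal (g x)}"
  hence x: "x \<in> S" "u x < ereal (g x)" by auto
  from x(2) have "u x + ereal (- g x) < 0" by (cases "u x") auto
  moreover have "usc_on S (\<lambda>x. u x + ereal (- g x))"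
    by (intro usc_on_add_continuous u continuous_intros g)
  ultimately have "eventually (\<lambda>y. u y + ereal (- g y) < 0) (at x within S)"
    using x(1) unfolding usc_on_def by blast
  then obtain W where W: "open W" "x \<in> W" "\<And>y. y \<in> W \<Longrightarrow> y \<noteq> x \<Longrightarrow> y \<in> S \<Longrightarrow> u y + ereal (- g y) < 0"
    unfolding eventually_at_topological by auto
  have "u y < ereal (g y)" if "y \<in> W \<inter> S" for y
  proof (cases "y = x")
    case False
    with W(3)[of y] that show ?thesis by (cases "u y") auto
  qed (use x in auto)
  thus "\<exists>T. open T \<and> x \<in> T \<and> T \<subseteq> {x\<in>S. u x < ereal (g x)}"
    using W(1,2) S x by (intro exI[of _ "W \<inter> S"]) auto
qed

lemma ereal_add_le_imp_le_diff: "a + ereal b \<le> ereal c \<Longrightarrow> a \<le> ereal (c - b)"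
  using ereal_le_minus[of "ereal b" a "ereal c"] by simp

section \<open>The maximum principle along a graph\<close>

text \<open>Plurisubharmonicity is tested on complex lines only; this lemma transfers it to the curved disks
\<open>x \<mapsto> (x, \<psi> x)\<close> without smoothing \<open>f\<close>. Suppose that the bound fails. In a thin compact
tube around the graph, maximise
\<open>f (x, y) - h x - \<epsilon> (M - |x|\<^sup>2) - N |y - \<psi> x|\<^sup>2\<close>.
For a large \<open>N\<close> and a small \<open>\<epsilon>\<close> the maximum point \<open>(x0, y0)\<close> lies in the interior of the tube. Compare
on the line \<open>l \<mapsto> (x0 + l, y0 + l \<psi>'(x0))\<close>, which is parallel to the tangent of the graph. With
\<open>w0 = y0 - \<psi> x0\<close> and \<open>R l = \<psi> (x0 + l) - \<psi> x0 - l \<psi>'(x0)\<close>, the penalty is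
\<open>N |w0 - R l|\<^sup>2 = N |w0|\<^sup>2 - 2 N Re (cnj w0 R l) + N |R l|\<^sup>2\<close>. The mixed term is harmonic and
vanishes at \<open>l = 0\<close>, and \<open>|R l|\<^sup>2 = o(|l|\<^sup>2)\<close> is dominated by the term \<open>\<epsilon> |x|\<^sup>2\<close>, whose mean
over a circle of radius \<open>r\<close> exceeds its value at the centre by \<open>\<epsilon> r\<^sup>2\<close>. As \<open>h\<close> is harmonic,
this contradicts the submean inequality for \<open>f\<close> on that line.\<close>
lemma psh_graph_maximum_principle:
  fixes f :: "complex \<times> complex \<Rightarrow> ereal" and \<psi> F :: "complex \<Rightarrow> complex" and c d :: real
  defines "h \<equiv> (\<lambda>x. c * ln (cmod (F x)) + d)"
  assumes psh: "plurisubharmonic_on D f"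
    and V: "open V" and \<psi>: "\<psi> holomorphic_on V" and graph: "\<And>x. x \<in> V \<Longrightarrow> (x, \<psi> x) \<in> D"
    and F: "F holomorphic_on V" "\<And>x. x \<in> V \<Longrightarrow> F x \<noteq> 0"
    and K: "compact K" "K \<subseteq> V"
    and bd: "\<And>x. x \<in> frontier K \<Longrightarrow> f (x, \<psi> x) \<le> ereal (h x)"
    and x1: "x1 \<in> K"
  shows "f (x1, \<psi> x1) \<le> ereal (h x1)"
proof (rule ccontr)
  assume "\<not> ?thesis"
  hence "ereal (h x1) < f (x1, \<psi> x1)" by simp
  then obtain e where e: "ereal (h x1) < ereal e" "ereal e < f (x1, \<psi> x1)"
    using ereal_dense2 by blast
  have openD: "open D" and usc: "usc_on D f" and fin: "\<And>z. z \<in> D \<Longrightarrow> f z < \<infinity>"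
    and lines: "\<And>a1 a2 b1 b2. subharmonic_on {l. (a1 + l * b1, a2 + l * b2) \<in> D}
                      (\<lambda>l. f (a1 + l * b1, a2 + l * b2))"
    using psh by (auto simp: plurisubharmonic_on_def)
  obtain M0 where M0: "\<And>x. x \<in> K \<Longrightarrow> cmod x \<le> M0"
    using compact_imp_bounded[OF K(1)] unfolding bounded_iff by blast
  define M where "M = (\<bar>M0\<bar> + 1)\<^sup>2"
  have M: "(cmod x)\<^sup>2 < M" if "x \<in> K" for x
    unfolding M_def using M0[OF that] by (intro power_strict_mono) auto
  have "M > 0" by (simp add: M_def)
  \<comment> \<open>The room between h and f at the bad point pays for the strictly superharmonic term in k.\<close>
  define \<epsilon> where "\<epsilon> = (e - h x1) / M"
  have \<epsilon>: "\<epsilon> > 0" using e(1) \<open>M > 0\<close> by (simp add: \<epsilon>_def)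
  define k where "k = (\<lambda>x. h x + \<epsilon> * (M - (cmod x)\<^sup>2))"
  have kh: "h x < k x" if "x \<in> K" for x using M[OF that] \<epsilon> by (simp add: k_def)
  have "k x1 \<le> h x1 + \<epsilon> * M" using \<epsilon> by (simp add: k_def)
  also have "\<dots> = e" using \<open>M > 0\<close> by (simp add: \<epsilon>_def)
  finally have fk1: "ereal (k x1) < f (x1, \<psi> x1)"
    using e(2) by (meson ereal_less_eq(3) le_less_trans)
  have h_cont: "continuous_on V h" unfolding h_def
    using F by (intro continuous_intros holomorphic_on_imp_continuous_on) auto
  hence k_cont: "continuous_on V k" unfolding k_def by (intro continuous_intros)
  have \<psi>_cont: "continuous_on V \<psi>" using \<psi> by (rule holomorphic_on_imp_continuous_on)
  hence \<gamma>_cont: "continuous_on V (\<lambda>x. (x, \<psi> x))" by (intro continuous_intros)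

  \<comment> \<open>The radius of the tube: it stays in D, and over the frontier of K the bound \<open>f < k\<close> persists.\<close>
  define S0 where "S0 = D \<inter> (V \<times> UNIV)"
  have S0: "open S0" unfolding S0_def using openD V by (intro open_Int open_Times) auto
  define O' where "O' = {z\<in>S0. f z < ereal (k (fst z))}"
  have "open O'" unfolding O'_def
    by (intro usc_on_less_open S0 usc_on_subset[OF usc] continuous_on_compose2[OF k_cont])
      (auto simp: S0_def intro!: continuous_intros)
  have frK: "frontier K \<subseteq> K" using K(1) by (simp add: compact_imp_closed frontier_subset_closed)
  have "compact ((\<lambda>x. (x, \<psi> x)) ` K)" "(\<lambda>x. (x, \<psi> x)) ` K \<subseteq> S0"
    using K graph by (auto intro!: compact_continuous_image continuous_on_subset[OF \<gamma>_cont] simp: S0_def)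
  from compact_subset_open_imp_cball_epsilon_subset[OF this(1) S0 this(2)]
  obtain \<tau>1 where \<tau>1: "\<tau>1 > 0" "(\<Union>z\<in>(\<lambda>x. (x, \<psi> x)) ` K. cball z \<tau>1) \<subseteq> S0" by blast
  have "compact ((\<lambda>x. (x, \<psi> x)) ` frontier K)"
    using K frK by (intro compact_continuous_image continuous_on_subset[OF \<gamma>_cont] compact_frontier) auto
  moreover have "(\<lambda>x. (x, \<psi> x)) ` frontier K \<subseteq> O'"
  proof (intro image_subsetI)
    fix x assume x: "x \<in> frontier K"
    hence "x \<in> K" using frK by auto
    moreover have "f (x, \<psi> x) < ereal (k x)"
      using bd[OF x] kh[OF \<open>x \<in> K\<close>] by (meson ereal_less(2) le_less_trans less_ereal.simps(1))
    ultimately show "(x, \<psi> x) \<in> O'" using K graph by (auto simp: O'_def S0_def)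
  qed
  ultimately obtain \<tau>2 where \<tau>2: "\<tau>2 > 0" "(\<Union>z\<in>(\<lambda>x. (x, \<psi> x)) ` frontier K. cball z \<tau>2) \<subseteq> O'"
    using compact_subset_open_imp_cball_epsilon_subset[OF _ \<open>open O'\<close>] by blast
  define \<tau> where "\<tau> = min \<tau>1 \<tau>2"
  have \<tau>: "\<tau> > 0" using \<tau>1 \<tau>2 by (simp add: \<tau>_def)
  have tubeD: "(x, \<psi> x + w) \<in> D" if "x \<in> K" "cmod w \<le> \<tau>" for x w
  proof -
    have "(x, \<psi> x + w) \<in> cball (x, \<psi> x) \<tau>1"
      using that by (simp add: dist_Pair_Pair dist_norm \<tau>_def)
    hence "(x, \<psi> x + w) \<in> S0" using \<tau>1(2) that(1) by blast
    thus ?thesis by (simp add: S0_def)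
  qed
  have tube_fr: "f (x, \<psi> x + w) < ereal (k x)" if "x \<in> frontier K" "cmod w \<le> \<tau>" for x w
  proof -
    have "(x, \<psi> x + w) \<in> cball (x, \<psi> x) \<tau>2"
      using that by (simp add: dist_Pair_Pair dist_norm \<tau>_def)
    hence "(x, \<psi> x + w) \<in> O'" using \<tau>2(2) that(1) by blast
    thus ?thesis by (simp add: O'_def)
  qed
  define T where "T = K \<times> cball (0::complex) \<tau>"
  define fT where "fT = (\<lambda>z. f (fst z, \<psi> (fst z) + snd z))"
  have T: "compact T" "T \<noteq> {}" using K x1 \<tau> by (auto simp: T_def intro!: compact_Times)
  have fT_usc: "usc_on T fT" unfolding fT_def
  proof (rule usc_on_compose[OF usc])
    show "continuous_on T (\<lambda>z. (fst z, \<psi> (fst z) + snd z))"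
      by (intro continuous_intros continuous_on_compose2[OF \<psi>_cont]) (use K in \<open>auto simp: T_def\<close>)
  qed (auto simp: T_def intro!: tubeD)
  have fT_fin: "fT z < \<infinity>" if "z \<in> T" for z
    unfolding fT_def by (rule fin[OF tubeD]) (use that in \<open>auto simp: T_def\<close>)
  obtain zB where zB: "zB \<in> T" "\<And>z. z \<in> T \<Longrightarrow> fT z \<le> fT zB"
    using usc_on_attains_max[OF T fT_usc] by blast
  obtain B where "fT zB < ereal B" using ereal_dense2[OF fT_fin[OF zB(1)]] by blast
  hence B: "fT z \<le> ereal B" if "z \<in> T" for z
    using zB(2)[OF that] by (meson le_less_trans less_imp_le)
  have "compact (k ` K)" using K by (intro compact_continuous_image continuous_on_subset[OF k_cont])
  then obtain B' where B': "\<And>x. x \<in> K \<Longrightarrow> \<bar>k x\<bar> \<le> B'"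
    using compact_imp_bounded[of "k ` K"] unfolding bounded_iff by auto
  \<comment> \<open>So large that the penalty outweighs f - k where the distance to the graph is \<open>\<tau>\<close>.\<close>
  define N where "N = (\<bar>B\<bar> + \<bar>B'\<bar> + 1) / \<tau>\<^sup>2"
  have "\<bar>B\<bar> + \<bar>B'\<bar> + 1 > 0" by linarith
  hence N: "N > 0" using \<tau> unfolding N_def by (intro divide_pos_pos zero_less_power)
  have N\<tau>: "N * \<tau>\<^sup>2 = \<bar>B\<bar> + \<bar>B'\<bar> + 1" using \<tau> by (simp add: N_def)

  \<comment> \<open>The frontier bound and the size of N keep the maximum point off the boundary of the tube.\<close>
  define u where "u = (\<lambda>z. fT z + ereal (- k (fst z) - N * (cmod (snd z))\<^sup>2))"
  have "usc_on T u" unfolding u_def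
    by (intro usc_on_add_continuous fT_usc continuous_intros continuous_on_compose2[OF k_cont])
      (use K in \<open>auto simp: T_def\<close>)
  from usc_on_attains_max[OF T this] obtain z0 where z0: "z0 \<in> T" "\<And>z. z \<in> T \<Longrightarrow> u z \<le> u z0"
    by blast
  obtain x0 w0 where z0_eq: "z0 = (x0, w0)" by fastforce
  have x0: "x0 \<in> K" and w0: "cmod w0 \<le> \<tau>" using z0(1) by (auto simp: T_def z0_eq)
  have "0 < u (x1, 0)" using fk1 by (cases "f (x1, \<psi> x1)") (auto simp: u_def fT_def)
  also have "\<dots> \<le> u z0" using x1 \<tau> by (intro z0(2)) (auto simp: T_def)
  finally have u0: "0 < u z0" .
  obtain f0 where f0: "f (x0, \<psi> x0 + w0) = ereal f0"
    using u0 fT_fin[OF z0(1)] by (cases "f (x0, \<psi> x0 + w0)") (auto simp: u_def fT_def z0_eq)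
  have f0_gt: "k x0 + N * (cmod w0)\<^sup>2 < f0" using u0 f0 by (simp add: u_def fT_def z0_eq)
  have "x0 \<notin> frontier K"
  proof
    assume "x0 \<in> frontier K"
    from tube_fr[OF this w0] have "f0 < k x0" by (simp add: f0)
    moreover have "0 \<le> N * (cmod w0)\<^sup>2" using N by simp
    ultimately show False using f0_gt by linarith
  qed
  hence x0_int: "x0 \<in> interior K" using x0 closure_subset[of K] by (auto simp: frontier_def)
  have "cmod w0 \<noteq> \<tau>"
  proof
    assume "cmod w0 = \<tau>"
    hence "k x0 + \<bar>B\<bar> + \<bar>B'\<bar> + 1 < f0" using f0_gt N\<tau> by simp
    moreover have "f0 \<le> B" using B[OF z0(1)] f0 by (simp add: fT_def z0_eq)
    moreover have "- B' \<le> k x0" using B'[OF x0] by simp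
    ultimately show False by linarith
  qed
  hence w0': "cmod w0 < \<tau>" using w0 by simp

  \<comment> \<open>Comparison along the line through the maximum point parallel to the tangent of the graph.\<close>
  obtain e1 where e1: "e1 > 0" "ball x0 e1 \<subseteq> K"
    using x0_int by (meson mem_interior)
  have ballV: "ball x0 e1 \<subseteq> V" using e1(2) K(2) by blast
  have "x0 \<in> ball x0 e1" using e1 by simp
  obtain L where L: "L holomorphic_on ball x0 e1" "\<And>x. x \<in> ball x0 e1 \<Longrightarrow> exp (L x) = F x"
    using holomorphic_logarithm_exists[OF convex_ball open_ball holomorphic_on_subset[OF F(1) ballV] _ \<open>x0 \<in> ball x0 e1\<close>] F(2) ballV
    by (metis subsetD)
  have hL: "h x = c * Re (L x) + d" if "x \<in> ball x0 e1" for x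
    unfolding h_def L(2)[OF that, symmetric] by simp
  define \<psi>' where "\<psi>' = deriv \<psi> x0"
  have "(\<psi> has_field_derivative \<psi>') (at x0)" unfolding \<psi>'_def
    by (rule holomorphic_derivI[OF \<psi> V]) (use K x0 in blast)
  hence deriv: "(\<psi> has_derivative (*) \<psi>') (at x0)" by (simp add: has_field_derivative_def)
  define R where "R = (\<lambda>l. \<psi> (x0 + l) - \<psi> x0 - \<psi>' * l)"
  \<comment> \<open>Chosen so that the remainder of the tangent line uses up half of the gain from k.\<close>
  define \<eta> where "\<eta> = sqrt (\<epsilon> / (2 * N))"
  have \<eta>: "\<eta> > 0" "N * \<eta>\<^sup>2 = \<epsilon> / 2" using \<epsilon> N by (auto simp: \<eta>_def)
  have "\<forall>e>0. \<exists>\<delta>>0. \<forall>y. cmod (y - x0) < \<delta> \<longrightarrow> cmod (\<psi> y - \<psi> x0 - \<psi>' * (y - x0)) \<le> e * cmod (y - x0)"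
    using deriv unfolding has_derivative_at_alt by (rule conjunct2)
  from this[rule_format, OF \<eta>(1)] obtain \<delta> where \<delta>: "\<delta> > 0"
    "\<And>y. cmod (y - x0) < \<delta> \<Longrightarrow> cmod (\<psi> y - \<psi> x0 - \<psi>' * (y - x0)) \<le> \<eta> * cmod (y - x0)"
    by blast
  define r where "r = min (min (e1 / 2) (\<delta> / 2)) ((\<tau> - cmod w0) / \<eta>)"
  have r_le: "r \<le> e1 / 2" "r \<le> \<delta> / 2" "r \<le> (\<tau> - cmod w0) / \<eta>" unfolding r_def by linarith+
  have "(\<tau> - cmod w0) / \<eta> > 0" using w0' \<eta>(1) by simp
  hence "0 < r" unfolding r_def using e1(1) \<delta>(1) by linarith
  hence r: "0 < r" "r < e1" "r < \<delta>" using r_le e1(1) \<delta>(1) by linarith+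
  have r\<tau>: "\<eta> * r \<le> \<tau> - cmod w0" using r_le(3) \<eta>(1) by (simp add: pos_le_divide_eq mult.commute)
  have R: "cmod (R l) \<le> \<eta> * cmod l" if "cmod l \<le> r" for l
    using \<delta>(2)[of "x0 + l"] that r by (simp add: R_def)
  have point: "x0 + l \<in> ball x0 e1" "x0 + l \<in> K" "cmod (w0 - R l) \<le> \<tau>"
    "(x0 + l * 1, \<psi> x0 + w0 + l * \<psi>') = (x0 + l, \<psi> (x0 + l) + (w0 - R l))" if "cmod l \<le> r" for l
  proof -
    show 1: "x0 + l \<in> ball x0 e1" using that r by (simp add: dist_norm)
    thus "x0 + l \<in> K" using e1 by auto
    have "cmod (R l) \<le> \<eta> * r" 
      by (rule order_trans[OF R[OF that] mult_left_mono[OF that less_imp_le[OF \<eta>(1)]]])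
    thus "cmod (w0 - R l) \<le> \<tau>" using r\<tau> norm_triangle_ineq4[of w0 "R l"] by linarith
    show "(x0 + l * 1, \<psi> x0 + w0 + l * \<psi>') = (x0 + l, \<psi> (x0 + l) + (w0 - R l))"
      by (simp add: R_def algebra_simps)
  qed
  \<comment> \<open>The majorant of f on the circle of radius r, with every term made harmonic: on this circle
    \<open>|l|\<^sup>2\<close> is the constant \<open>r\<^sup>2\<close>.\<close>
  define H where "H = (\<lambda>l. of_real (f0 - k x0 + d + \<epsilon> * M - \<epsilon> * (cmod x0)\<^sup>2 - (\<epsilon> / 2) * r\<^sup>2)
     + of_real c * L (x0 + l) - 2 * of_real \<epsilon> * (cnj x0 * l) - 2 * of_real N * (cnj w0 * R l))"
  have L_hol: "(\<lambda>l. L (x0 + l)) holomorphic_on ball 0 e1"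
    by (rule holomorphic_on_compose_gen[OF _ L(1), of "\<lambda>l. x0 + l", unfolded o_def])
      (auto intro!: holomorphic_intros simp: dist_norm)
  have \<psi>_hol: "(\<lambda>l. \<psi> (x0 + l)) holomorphic_on ball 0 e1"
    by (rule holomorphic_on_compose_gen[OF _ holomorphic_on_subset[OF \<psi> ballV], of "\<lambda>l. x0 + l", unfolded o_def])
      (auto intro!: holomorphic_intros simp: dist_norm)
  have H_hol: "H holomorphic_on ball 0 e1" unfolding H_def R_def
    by (intro holomorphic_intros L_hol \<psi>_hol)
  have "f (x0 + 0 * 1, \<psi> x0 + w0 + 0 * \<psi>') \<le> ereal (Re (H 0))"
  proof (rule subharmonic_le_Re[OF lines[of x0 1 "\<psi> x0 + w0" \<psi>'] _ r(1)])
    show "cball 0 r \<subseteq> {l. (x0 + l * 1, \<psi> x0 + w0 + l * \<psi>') \<in> D}"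
    proof
      fix l :: complex assume "l \<in> cball 0 r"
      hence l: "cmod l \<le> r" by simp
      show "l \<in> {l. (x0 + l * 1, \<psi> x0 + w0 + l * \<psi>') \<in> D}"
        unfolding mem_Collect_eq point(4)[OF l] by (rule tubeD[OF point(2,3)[OF l]])
    qed
    have "cball 0 r \<subseteq> ball (0::complex) e1" "ball 0 r \<subseteq> ball (0::complex) e1" using r by auto
    note sub = this[THEN holomorphic_on_subset[OF H_hol]]
    show "continuous_on (cball 0 r) H" by (rule holomorphic_on_imp_continuous_on[OF sub(1)])
    show "H holomorphic_on ball 0 r" by (rule sub(2))
    fix l :: complex assume "l \<in> sphere 0 r"
    hence lr: "cmod l = r" by simp
    note P = point[OF eq_refl[OF lr]]
    have "u (x0 + l, w0 - R l) \<le> u z0" by (intro z0(2)) (use P in \<open>auto simp: T_def\<close>)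
    hence "f (x0 + l, \<psi> (x0 + l) + (w0 - R l)) + ereal (- k (x0 + l) - N * (cmod (w0 - R l))\<^sup>2)
        \<le> ereal (f0 + (- k x0 - N * (cmod w0)\<^sup>2))"
      by (simp add: u_def fT_def z0_eq f0)
    hence le: "f (x0 + l, \<psi> (x0 + l) + (w0 - R l)) \<le>
        ereal (f0 + (- k x0 - N * (cmod w0)\<^sup>2) - (- k (x0 + l) - N * (cmod (w0 - R l))\<^sup>2))"
      by (rule ereal_add_le_imp_le_diff)
    have "f0 + (- k x0 - N * (cmod w0)\<^sup>2) - (- k (x0 + l) - N * (cmod (w0 - R l))\<^sup>2) \<le> Re (H l)"
    proof -
      have "(cmod (R l))\<^sup>2 \<le> (\<eta> * r)\<^sup>2" using R[of l] lr by (intro power_mono) auto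
      hence "N * (cmod (R l))\<^sup>2 \<le> N * (\<eta> * r)\<^sup>2" using N by (intro mult_left_mono) auto
      also have "\<dots> = \<epsilon> / 2 * r\<^sup>2" using \<eta>(2) by (simp add: power_mult_distrib)
      finally have R2: "N * (cmod (R l))\<^sup>2 \<le> \<epsilon> / 2 * r\<^sup>2" .
      have w: "(cmod (w0 - R l))\<^sup>2 = (cmod w0)\<^sup>2 - 2 * Re (cnj w0 * R l) + (cmod (R l))\<^sup>2"
        unfolding cmod_power2 by (simp add: power2_eq_square algebra_simps)
      have x: "(cmod (x0 + l))\<^sup>2 = (cmod x0)\<^sup>2 + 2 * Re (cnj x0 * l) + r\<^sup>2"
        unfolding lr[symmetric] cmod_power2 by (simp add: power2_eq_square algebra_simps)
      have kx: "k (x0 + l) = c * Re (L (x0 + l)) + d + \<epsilon> * M - \<epsilon> * (cmod x0)\<^sup>2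
          - 2 * (\<epsilon> * Re (cnj x0 * l)) - \<epsilon> * r\<^sup>2"
        unfolding k_def hL[OF P(1)] x by (simp add: algebra_simps)
      have HRe: "Re (H l) = f0 - k x0 + d + \<epsilon> * M - \<epsilon> * (cmod x0)\<^sup>2 - (\<epsilon> / 2) * r\<^sup>2
          + c * Re (L (x0 + l)) - 2 * (\<epsilon> * Re (cnj x0 * l)) - 2 * (N * Re (cnj w0 * R l))"
        unfolding H_def by simp
      have "N * (cmod (w0 - R l))\<^sup>2 = N * (cmod w0)\<^sup>2 - 2 * (N * Re (cnj w0 * R l)) + N * (cmod (R l))\<^sup>2"
        unfolding w by (simp add: algebra_simps)
      thus ?thesis unfolding HRe kx using R2 by linarith
    qed
    hence "ereal (f0 + (- k x0 - N * (cmod w0)\<^sup>2) - (- k (x0 + l) - N * (cmod (w0 - R l))\<^sup>2)) \<le> ereal (Re (H l))"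
      by (simp only: ereal_less_eq)
    with le show "f (x0 + l * 1, \<psi> x0 + w0 + l * \<psi>') \<le> ereal (Re (H l))"
      unfolding P(4) by (rule order_trans)
  qed
  moreover have "Re (H 0) = f0 - \<epsilon> / 2 * r\<^sup>2"
    using hL[of x0] e1 by (simp add: H_def R_def k_def algebra_simps)
  ultimately have "f0 \<le> f0 - \<epsilon> / 2 * r\<^sup>2" by (simp add: f0)
  moreover have "\<epsilon> / 2 * r\<^sup>2 > 0" using \<epsilon> r by simp
  ultimately show False by linarith
qed

section \<open>Competitors along a graph through both poles\<close>

text \<open>A logarithmic pole says nothing about the value at the pole itself; the submean inequality on
small circles around it does.\<close>
lemma log_pole_imp_MInf:
  assumes psh: "plurisubharmonic_on D f" and a: "a \<in> D" and pole: "log_pole f a"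
  shows "f a = -\<infinity>"
proof (rule ereal_bot)
  fix m :: real
  obtain a1 a2 where a_eq: "a = (a1, a2)" by fastforce
  have D: "open D" and sh: "subharmonic_on {l. (a1 + l * 1, a2 + l * 0) \<in> D} (\<lambda>l. f (a1 + l * 1, a2 + l * 0))"
    using psh unfolding plurisubharmonic_on_def by blast+
  obtain C where "eventually (\<lambda>y. f y \<le> ereal (ln (norm (y - a)) + C)) (at a)"
    using pole by (auto simp: log_pole_def)
  then obtain d where d: "d > 0" "\<And>y. y \<noteq> a \<Longrightarrow> dist y a < d \<Longrightarrow> f y \<le> ereal (ln (norm (y - a)) + C)"
    unfolding eventually_at by auto
  obtain e where e: "e > 0" "ball a e \<subseteq> D" using D a by (meson openE)
  \<comment> \<open>The last entry makes \<open>ln r + C\<close> at most m.\<close>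
  define r where "r = min (min (d / 2) (e / 2)) (exp (m - C))"
  have r: "r > 0" "r < d" "r < e" "r \<le> exp (m - C)" using d(1) e(1) by (auto simp: r_def)
  have dist: "dist (a1 + l * 1, a2 + l * 0) a = cmod l" for l
    by (simp add: a_eq dist_Pair_Pair dist_norm)
  have "f (a1 + 0 * 1, a2 + 0 * 0) \<le> ereal (Re (of_real (ln r + C)))"
  proof (rule subharmonic_le_Re[OF sh _ r(1)])
    show "cball 0 r \<subseteq> {l. (a1 + l * 1, a2 + l * 0) \<in> D}"
    proof
      fix l :: complex assume "l \<in> cball 0 r"
      hence "(a1 + l * 1, a2 + l * 0) \<in> ball a e" using r dist[of l] by (simp add: dist_commute)
      thus "l \<in> {l. (a1 + l * 1, a2 + l * 0) \<in> D}" using e(2) by blast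
    qed
    fix l :: complex assume "l \<in> sphere 0 r"
    hence l: "cmod l = r" by simp
    have ne: "(a1 + l * 1, a2 + l * 0) \<noteq> a" using dist[of l] l r(1) by fastforce
    have lt: "dist (a1 + l * 1, a2 + l * 0) a < d" unfolding dist l by (rule r(2))
    from d(2)[OF ne lt] show "f (a1 + l * 1, a2 + l * 0) \<le> ereal (Re (of_real (ln r + C)))"
      unfolding dist_norm[symmetric] dist l by simp
  qed (intro continuous_intros holomorphic_intros)+
  hence "f a \<le> ereal (ln r + C)" by (simp add: a_eq)
  also have "ln r \<le> ln (exp (m - C))" using r by (subst ln_le_cancel_iff) auto
  hence "ereal (ln r + C) \<le> ereal m" by simp
  finally show "f a \<le> ereal m" .
qed

text \<open>The unknown additive constant in the definition of a logarithmic pole is absorbed by giving up a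
small multiple \<open>\<delta>\<close> of the logarithm, which tends to minus infinity.\<close>
lemma log_pole_along_graph:
  fixes G :: "complex \<Rightarrow> real"
  assumes pole: "log_pole f (a, \<psi> a)" and \<psi>: "(\<psi> has_field_derivative \<psi>') (at a)"
    and G: "c > 0" "eventually (\<lambda>x. c * cmod (x - a) \<le> G x) (at a)"
    and \<delta>: "0 < \<delta>" "\<delta> < 1"
  shows "eventually (\<lambda>x. f (x, \<psi> x) \<le> ereal ((1 - \<delta>) * ln (G x))) (at a)"
proof -
  obtain C where C: "eventually (\<lambda>y. f y \<le> ereal (ln (norm (y - (a, \<psi> a))) + C)) (at (a, \<psi> a))"
    using pole by (auto simp: log_pole_def)
  have "(\<psi> \<longlongrightarrow> \<psi> a) (at a)" using DERIV_isCont[OF \<psi>] by (simp add: isCont_def)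
  hence "filterlim (\<lambda>x. (x, \<psi> x)) (at (a, \<psi> a)) (at a)"
    by (intro filterlim_atI tendsto_intros) (auto simp: eventually_at_filter)
  with C have ev1: "eventually (\<lambda>x. f (x, \<psi> x) \<le> ereal (ln (norm ((x, \<psi> x) - (a, \<psi> a))) + C)) (at a)"
    by (rule eventually_compose_filterlim)
  define B where "B = cmod \<psi>' + 2"
  have B: "B > 0" by (simp add: B_def add_nonneg_pos)
  have "(\<psi> has_derivative (*) \<psi>') (at a)" using \<psi> by (simp add: has_field_derivative_def)
  hence "\<forall>e>0. \<exists>d>0. \<forall>y. cmod (y - a) < d \<longrightarrow> cmod (\<psi> y - \<psi> a - \<psi>' * (y - a)) \<le> e * cmod (y - a)"
    unfolding has_derivative_at_alt by (rule conjunct2)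
  from this[rule_format, of 1] obtain d where d: "d > 0"
    "\<And>y. cmod (y - a) < d \<Longrightarrow> cmod (\<psi> y - \<psi> a - \<psi>' * (y - a)) \<le> cmod (y - a)" by auto
  have ev2: "eventually (\<lambda>x. norm ((x, \<psi> x) - (a, \<psi> a)) \<le> B * cmod (x - a)) (at a)"
    unfolding eventually_at
  proof (intro exI[of _ d] conjI ballI impI d(1))
    fix x assume "x \<noteq> a \<and> dist x a < d"
    hence "cmod (\<psi> x - \<psi> a - \<psi>' * (x - a)) \<le> cmod (x - a)" by (intro d(2)) (simp add: dist_norm)
    moreover have "cmod (\<psi> x - \<psi> a) \<le> cmod (\<psi> x - \<psi> a - \<psi>' * (x - a)) + cmod \<psi>' * cmod (x - a)"
      using norm_triangle_ineq[of "\<psi> x - \<psi> a - \<psi>' * (x - a)" "\<psi>' * (x - a)"]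
      unfolding norm_mult by simp
    moreover have "norm ((x, \<psi> x) - (a, \<psi> a)) \<le> cmod (x - a) + cmod (\<psi> x - \<psi> a)"
      using norm_Pair_le[of "x - a" "\<psi> x - \<psi> a"] by simp
    moreover have "B * cmod (x - a) = cmod \<psi>' * cmod (x - a) + 2 * cmod (x - a)"
      unfolding B_def by (rule distrib_right)
    ultimately show "norm ((x, \<psi> x) - (a, \<psi> a)) \<le> B * cmod (x - a)" by linarith
  qed
  define E where "E = ((1 - \<delta>) * ln c - ln B - C) / \<delta>"
  have "filterlim (\<lambda>x. cmod (x - a)) (at_right 0) (at a)"
  proof -
    have "((\<lambda>x. cmod (x - a)) \<longlongrightarrow> cmod (a - a)) (at a)" by (intro tendsto_intros)
    thus ?thesis by (auto simp: filterlim_at eventually_at_filter)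
  qed
  from filterlim_compose[OF ln_at_0 this]
  have "eventually (\<lambda>x. ln (cmod (x - a)) \<le> E) (at a)" by (auto simp: filterlim_at_bot)
  thus ?thesis using ev1 ev2 G(2) eventually_neq_at_within[of a]
  proof eventually_elim
    case (elim x)
    have pos: "cmod (x - a) > 0" using elim(5) by simp
    have "norm ((x, \<psi> x) - (a, \<psi> a)) > 0" using elim(5) by (simp add: zero_prod_def)
    hence "ln (norm ((x, \<psi> x) - (a, \<psi> a))) \<le> ln (B * cmod (x - a))"
      using elim(3) by (intro ln_mono) auto
    also have "\<dots> = ln B + ln (cmod (x - a))" using B pos by (simp add: ln_mult)
    finally have 1: "ln (norm ((x, \<psi> x) - (a, \<psi> a))) \<le> ln B + ln (cmod (x - a))" .
    have "\<delta> * ln (cmod (x - a)) \<le> \<delta> * E" using elim(1) \<delta> by (intro mult_left_mono) auto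
    also have "\<delta> * E = (1 - \<delta>) * ln c - ln B - C" using \<delta> by (simp add: E_def)
    finally have "ln B + ln (cmod (x - a)) + C \<le> (1 - \<delta>) * (ln c + ln (cmod (x - a)))"
      by (simp add: algebra_simps)
    also have "ln c + ln (cmod (x - a)) = ln (c * cmod (x - a))" using G(1) pos by (simp add: ln_mult)
    also have "(1 - \<delta>) * \<dots> \<le> (1 - \<delta>) * ln (G x)"
      using \<delta> elim(4) G(1) pos by (intro mult_left_mono ln_mono) auto
    finally have "ln (norm ((x, \<psi> x) - (a, \<psi> a))) + C \<le> (1 - \<delta>) * ln (G x)" using 1 by linarith
    thus ?case using elim(2) by (meson ereal_less_eq(3) order_trans)
  qed
qed

lemma mult_mobius_near_sphere:
  assumes p: "cmod p < 1" and \<delta>: "0 < \<delta>"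
  obtains s where "s < 1" "\<And>x. s \<le> cmod x \<Longrightarrow> cmod x < 1 \<Longrightarrow> - \<delta> \<le> ln (cmod (x * mobius p x))"
proof -
  define Z where "Z = {x \<in> cball 0 1. cmod (x * mobius p x) \<le> exp (- \<delta>)}"
  have cont: "continuous_on (cball 0 1) (\<lambda>x. cmod (x * mobius p x))" unfolding mobius_def
    by (intro continuous_intros) (use mobius_denom_nz p in auto)
  have "Z = cball 0 1 \<inter> (\<lambda>x. cmod (x * mobius p x)) -` {..exp (- \<delta>)}" by (auto simp: Z_def)
  hence "closed Z" using continuous_closed_preimage[OF cont closed_cball closed_atMost] by simp
  moreover have "bounded Z" unfolding Z_def by (rule bounded_subset[OF bounded_cball[of 0 1]]) auto
  ultimately have "compact (insert 0 Z)" by (intro compact_insert) (simp add: compact_eq_bounded_closed)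
  from continuous_attains_sup[OF this _ continuous_on_norm_id]
  obtain x0 where x0: "x0 \<in> insert 0 Z" "\<And>y. y \<in> insert 0 Z \<Longrightarrow> cmod y \<le> cmod x0"
    by blast
  have "cmod x0 < 1"
  proof (rule ccontr)
    assume "\<not> cmod x0 < 1"
    hence 1: "cmod x0 = 1" "x0 \<in> Z" using x0(1) by (auto simp: Z_def)
    hence "1 \<le> exp (- \<delta>)" using mobius_norm_eq_1[OF p 1(1)] by (simp add: Z_def norm_mult)
    thus False using \<delta> by simp
  qed
  show thesis
  proof (rule that[of "(cmod x0 + 1) / 2"])
    show "(cmod x0 + 1) / 2 < 1" using \<open>cmod x0 < 1\<close> by simp
    fix x assume x: "(cmod x0 + 1) / 2 \<le> cmod x" "cmod x < 1"
    hence "x \<notin> Z" using x0(2)[of x] \<open>cmod x0 < 1\<close> by auto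
    hence "exp (- \<delta>) < cmod (x * mobius p x)" using x by (auto simp: Z_def)
    thus "- \<delta> \<le> ln (cmod (x * mobius p x))"
      by (metis exp_gt_zero ln_exp ln_mono less_imp_le)
  qed
qed

lemma eventually_mult_mobius_ge_at_0:
  assumes p: "p \<noteq> 0" "cmod p < 1"
  shows "eventually (\<lambda>x. cmod p / 2 * cmod (x - 0) \<le> cmod (x * mobius p x)) (at 0)"
proof -
  have "((\<lambda>x. cmod (mobius p x)) \<longlongrightarrow> cmod (mobius p 0)) (at 0)"
    unfolding mobius_def by (intro tendsto_intros) auto
  moreover have "cmod p / 2 < cmod (mobius p 0)" using p by (simp add: mobius_def)
  ultimately have "eventually (\<lambda>x. cmod p / 2 < cmod (mobius p x)) (at 0)" by (rule order_tendstoD(1))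
  thus ?thesis
  proof eventually_elim
    case (elim x)
    have "cmod p / 2 * cmod x \<le> cmod (mobius p x) * cmod x" using elim by (intro mult_right_mono) auto
    thus ?case by (simp add: norm_mult mult.commute)
  qed
qed

lemma eventually_mult_mobius_ge_at_self:
  assumes p: "p \<noteq> 0" "cmod p < 1"
  shows "eventually (\<lambda>x. cmod p / 2 * cmod (x - p) \<le> cmod (x * mobius p x)) (at p)"
proof -
  define g where "g = (\<lambda>x. cmod x / cmod (1 - cnj p * x))"
  have nz: "1 - cnj p * p \<noteq> 0" using mobius_denom_nz[of p p] p by simp
  have "(g \<longlongrightarrow> g p) (at p)" unfolding g_def using nz by (intro tendsto_intros) auto
  moreover have "cmod p / 2 < g p"
  proof -
    have "cmod (1 - cnj p * p) \<le> 1 + cmod (cnj p * p)" using norm_triangle_ineq4[of 1 "cnj p * p"] by simp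
    also have "cmod (cnj p * p) < 1" using norm_mult_less[of "cnj p" 1 p 1] p by simp
    finally have "cmod (1 - cnj p * p) < 2" by simp
    thus ?thesis unfolding g_def using p nz by (intro divide_strict_left_mono) auto
  qed
  ultimately have "eventually (\<lambda>x. cmod p / 2 < g x) (at p)" by (rule order_tendstoD(1))
  thus ?thesis
  proof eventually_elim
    case (elim x)
    have "cmod p / 2 * cmod (x - p) \<le> g x * cmod (x - p)" using elim by (intro mult_right_mono) auto
    also have "\<dots> = cmod (x * mobius p x)"
      by (simp add: g_def mobius_def norm_mult norm_divide norm_minus_commute)
    finally show ?case .
  qed
qed

text \<open>The maximum principle is applied on the disk of radius \<open>s\<close> minus small disks around 0 and \<open>p\<close>.
On the outer circle the right-hand side is nonnegative for \<open>s\<close> close to 1, because the Blaschke product has modulus 1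
on the unit circle; on the inner circles the poles of \<open>f\<close> are compared with those of the right-hand side.\<close>
lemma two_pole_graph_bound_approx:
  fixes f :: "complex \<times> complex \<Rightarrow> ereal"
  assumes psh: "plurisubharmonic_on bidisk f" and neg: "\<And>z. z \<in> bidisk \<Longrightarrow> f z < 0"
    and p: "p \<noteq> 0" "cmod p < 1"
    and poles: "log_pole f (p, \<psi> p)" "log_pole f (0, \<psi> 0)"
    and \<psi>: "\<psi> holomorphic_on ball 0 1" "\<And>x. cmod x < 1 \<Longrightarrow> cmod (\<psi> x) < 1"
    and x: "cmod x < 1" "x \<noteq> 0" "x \<noteq> p" and \<delta>: "0 < \<delta>" "\<delta> < 1"
  shows "f (x, \<psi> x) \<le> ereal ((1 - \<delta>) * ln (cmod (x * mobius p x)) + \<delta>)"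
proof -
  define F where "F = (\<lambda>x. x * mobius p x)"
  define V where "V = ball 0 1 - {0, p}"
  have V: "open V" unfolding V_def by (intro open_Diff open_ball) auto
  have graph: "(y, \<psi> y) \<in> bidisk" if "cmod y < 1" for y
    using \<psi>(2) that by (auto simp: bidisk_def)
  have der: "(\<psi> has_field_derivative deriv \<psi> a) (at a)" if "cmod a < 1" for a
    using \<psi>(1) that by (intro holomorphic_derivI[of _ "ball 0 1"]) auto
  have "eventually (\<lambda>y. f (y, \<psi> y) \<le> ereal ((1 - \<delta>) * ln (cmod (F y)))) (at 0)"
    unfolding F_def using log_pole_along_graph[OF poles(2) der _ eventually_mult_mobius_ge_at_0[OF p] \<delta>] p
    by simp
  then obtain d1 where d1: "d1 > 0"
    "\<And>y. y \<noteq> 0 \<Longrightarrow> cmod y < d1 \<Longrightarrow> f (y, \<psi> y) \<le> ereal ((1 - \<delta>) * ln (cmod (F y)))"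
    unfolding eventually_at by (auto simp: dist_norm)
  have "eventually (\<lambda>y. f (y, \<psi> y) \<le> ereal ((1 - \<delta>) * ln (cmod (F y)))) (at p)"
    unfolding F_def using log_pole_along_graph[OF poles(1) der _ eventually_mult_mobius_ge_at_self[OF p] \<delta>] p
    by simp
  then obtain d2 where d2: "d2 > 0"
    "\<And>y. y \<noteq> p \<Longrightarrow> cmod (y - p) < d2 \<Longrightarrow> f (y, \<psi> y) \<le> ereal ((1 - \<delta>) * ln (cmod (F y)))"
    unfolding eventually_at by (auto simp: dist_norm)
  obtain s0 where s0: "s0 < 1" "\<And>y. s0 \<le> cmod y \<Longrightarrow> cmod y < 1 \<Longrightarrow> - \<delta> \<le> ln (cmod (F y))"
    using mult_mobius_near_sphere[OF p(2) \<delta>(1)] unfolding F_def by metis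
  define s r1 r2 where "s = max s0 (cmod x)" and "r1 = min (d1 / 2) (cmod x)"
    and "r2 = min (d2 / 2) (cmod (x - p))"
  have s: "s < 1" "s0 \<le> s" "cmod x \<le> s" using s0(1) x by (auto simp: s_def)
  have r1: "0 < r1" "r1 < d1" "r1 \<le> cmod x" using d1(1) x by (auto simp: r1_def)
  have r2: "0 < r2" "r2 < d2" "r2 \<le> cmod (x - p)" using d2(1) x by (auto simp: r2_def)
  define K where "K = cball 0 s - ball 0 r1 - ball p r2"
  have K: "compact K" unfolding K_def by (intro compact_diff compact_cball open_ball)
  have inK: "y \<in> K \<longleftrightarrow> cmod y \<le> s \<and> r1 \<le> cmod y \<and> r2 \<le> cmod (y - p)" for y
    by (auto simp: K_def dist_norm norm_minus_commute)
  have KV: "K \<subseteq> V" using s r1 r2 by (auto simp: inK V_def)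
  have "f (x, \<psi> x) \<le> ereal ((1 - \<delta>) * ln (cmod (F x)) + \<delta>)"
  proof (rule psh_graph_maximum_principle[OF psh V _ _ _ _ K KV])
    show "\<psi> holomorphic_on V" by (rule holomorphic_on_subset[OF \<psi>(1)]) (auto simp: V_def)
    show "(y, \<psi> y) \<in> bidisk" if "y \<in> V" for y using that by (intro graph) (auto simp: V_def)
    show "F holomorphic_on V" unfolding F_def
      by (intro holomorphic_intros holomorphic_on_subset[OF mobius_holomorphic_on[OF p(2)]]) (auto simp: V_def)
    show "F y \<noteq> 0" if "y \<in> V" for y
      using that mobius_denom_nz[of p y] p by (auto simp: V_def F_def mobius_def)
    show "x \<in> K" using s r1 r2 by (simp add: inK)
    fix y assume y: "y \<in> frontier K"
    have yK: "y \<in> K" using y K by (meson compact_imp_closed frontier_subset_closed subsetD)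
    have y1: "cmod y < 1" using yK s by (simp add: inK)
    have "\<not> (cmod y < s \<and> r1 < cmod y \<and> r2 < cmod (y - p))"
    proof
      assume a: "cmod y < s \<and> r1 < cmod y \<and> r2 < cmod (y - p)"
      have "y \<in> interior K"
      proof (rule interiorI)
        show "open (ball 0 s - cball 0 r1 - cball p r2)" by (intro open_Diff open_ball closed_cball)
        show "y \<in> ball 0 s - cball 0 r1 - cball p r2" using a by (auto simp: dist_norm norm_minus_commute)
        show "ball 0 s - cball 0 r1 - cball p r2 \<subseteq> K" by (auto simp: K_def)
      qed
      thus False using y by (simp add: frontier_def)
    qed
    then consider "cmod y = s" | "cmod y = r1" | "cmod (y - p) = r2"
      using yK unfolding inK by linarith
    thus "f (y, \<psi> y) \<le> ereal ((1 - \<delta>) * ln (cmod (F y)) + \<delta>)"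
    proof cases
      case 1
      have "(1 - \<delta>) * (- \<delta>) \<le> (1 - \<delta>) * ln (cmod (F y))"
        using \<delta> s 1 y1 by (intro mult_left_mono s0(2)) auto
      hence "0 \<le> (1 - \<delta>) * ln (cmod (F y)) + \<delta>" using \<delta> by (simp add: algebra_simps)
        (smt (verit) mult_nonneg_nonneg)
      hence "0 \<le> ereal ((1 - \<delta>) * ln (cmod (F y)) + \<delta>)" by simp
      with neg[OF graph[OF y1]] show ?thesis by (meson le_less_trans less_imp_le less_le_trans)
    next
      case 2
      have "f (y, \<psi> y) \<le> ereal ((1 - \<delta>) * ln (cmod (F y)))" using 2 r1 by (intro d1(2)) auto
      also have "\<dots> \<le> ereal ((1 - \<delta>) * ln (cmod (F y)) + \<delta>)" using \<delta> by simp
      finally show ?thesis .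
    next
      case 3
      have "f (y, \<psi> y) \<le> ereal ((1 - \<delta>) * ln (cmod (F y)))" using 3 r2 by (intro d2(2)) auto
      also have "\<dots> \<le> ereal ((1 - \<delta>) * ln (cmod (F y)) + \<delta>)" using \<delta> by simp
      finally show ?thesis .
    qed
  qed
  thus ?thesis by (simp add: F_def)
qed

text \<open>Let \<open>\<delta>\<close> tend to 0 in the previous lemma; at 0 and \<open>p\<close> both sides are minus infinity.\<close>
lemma two_pole_graph_bound:
  fixes f :: "complex \<times> complex \<Rightarrow> ereal"
  assumes psh: "plurisubharmonic_on bidisk f" and neg: "\<And>z. z \<in> bidisk \<Longrightarrow> f z < 0"
    and p: "p \<noteq> 0" "cmod p < 1"
    and poles: "log_pole f (p, \<psi> p)" "log_pole f (0, \<psi> 0)"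
    and \<psi>: "\<psi> holomorphic_on ball 0 1" "\<And>x. cmod x < 1 \<Longrightarrow> cmod (\<psi> x) < 1"
    and x: "cmod x < 1"
  shows "f (x, \<psi> x) \<le> elog (cmod (x * mobius x p))"
proof (cases "x = 0 \<or> x = p")
  case True
  hence "log_pole f (x, \<psi> x)" using poles by auto
  moreover have "(x, \<psi> x) \<in> bidisk" using \<psi>(2) x by (auto simp: bidisk_def)
  ultimately show ?thesis using log_pole_imp_MInf[OF psh] by simp
next
  case False
  define L where "L = ln (cmod (x * mobius p x))"
  have nz: "cmod (x * mobius p x) > 0"
    using False x mobius_denom_nz[of p x] p by (auto simp: mobius_def)
  have "f (x, \<psi> x) \<le> ereal L"
  proof (rule ccontr)
    assume "\<not> f (x, \<psi> x) \<le> ereal L"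
    hence "ereal L < f (x, \<psi> x)" by simp
    from ereal_dense2[OF this] obtain e where e: "L < e" "ereal e < f (x, \<psi> x)" by auto
    \<comment> \<open>Solves \<open>(1 - \<delta>) L + \<delta> \<le> e\<close>.\<close>
    define \<delta> where "\<delta> = min (1 / 2) ((e - L) / (1 + \<bar>L\<bar>))"
    have \<delta>: "0 < \<delta>" "\<delta> < 1" using e(1) by (auto simp: \<delta>_def)
    have "\<delta> \<le> (e - L) / (1 + \<bar>L\<bar>)" by (simp add: \<delta>_def)
    hence "\<delta> * (1 + \<bar>L\<bar>) \<le> e - L" by (subst (asm) pos_le_divide_eq) auto
    moreover have "\<delta> * (- L) \<le> \<delta> * \<bar>L\<bar>" using \<delta>(1) by (intro mult_left_mono) auto
    ultimately have "(1 - \<delta>) * L + \<delta> \<le> e" by (simp add: algebra_simps)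
    moreover have "f (x, \<psi> x) \<le> ereal ((1 - \<delta>) * L + \<delta>)" unfolding L_def
      using two_pole_graph_bound_approx[OF psh neg p poles \<psi> x _ _ \<delta>] False by simp
    ultimately have "f (x, \<psi> x) \<le> ereal e" by (meson ereal_less_eq(3) order_trans)
    thus False using e(2) by simp
  qed
  also have "ereal L = elog (cmod (x * mobius p x))" using nz by (simp add: elog_def L_def)
  also have "cmod (x * mobius p x) = cmod (x * mobius x p)"
    by (simp only: norm_mult cmod_mobius_commute)
  finally show ?thesis .
qed

lemma green_le_graph:
  assumes "p \<noteq> 0" "cmod p < 1"
    and "\<psi> holomorphic_on ball 0 1" "\<And>x. cmod x < 1 \<Longrightarrow> cmod (\<psi> x) < 1"
    and "\<psi> p = 0" "\<psi> 0 = q" "\<psi> z1 = z2" "cmod z1 < 1"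
  shows "green (z1, z2) (p, 0) (0, q) \<le> elog (cmod (z1 * mobius z1 p))"
  unfolding green_def
proof (rule SUP_least, clarify)
  fix f assume "plurisubharmonic_on bidisk f" "\<forall>y\<in>bidisk. f y < 0" "log_pole f (p, 0)" "log_pole f (0, q)"
  thus "f (z1, z2) \<le> elog (cmod (z1 * mobius z1 p))"
    using two_pole_graph_bound[of f p \<psi> z1] assms by simp
qed

lemma mobius_0_right [simp]: "mobius a 0 = a" and mobius_self [simp]: "mobius a a = 0"
  by (simp_all add: mobius_def)

lemma norm_mult_less_1: "cmod u < 1 \<Longrightarrow> cmod v \<le> 1 \<Longrightarrow> cmod (u * v) < 1"
  using mult_left_le[of "cmod v" "cmod u"] by (simp add: norm_mult)

section \<open>The extremal disks\<close>

text \<open>Interpolation in the manner of Schwarz and Pick: \<open>mobius z2 \<circ> \<psi> = mobius z1 * g\<close> says that \<open>\<psi>\<close> maps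
\<open>z1\<close> to \<open>z2\<close>, and the two equations for \<open>g\<close> say that the graph of \<open>\<psi>\<close> passes through \<open>(p, 0)\<close> and \<open>(0, q)\<close>.\<close>
lemma mobius_disc_through:
  assumes z: "cmod z1 < 1" "cmod z2 < 1" and p: "cmod p < 1" "p \<noteq> 0" and q: "cmod q < 1"
    and g: "g holomorphic_on ball 0 1" "\<And>x. cmod x < 1 \<Longrightarrow> cmod (g x) \<le> 1"
    and gp: "mobius z1 p * g p = z2" and g0: "z1 * g 0 = mobius z2 q"
  defines "\<psi> \<equiv> (\<lambda>x. mobius z2 (mobius z1 x * g x))"
  shows "green (z1, z2) (p, 0) (0, q) \<le> elog (cmod (z1 * mobius z1 p))"
proof (rule green_le_graph[OF p(2,1)])
  have in1: "cmod (mobius z1 x * g x) < 1" if "cmod x < 1" for x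
    using mobius_norm_less_1[OF z(1) that] g(2)[OF that] by (rule norm_mult_less_1)
  have "(\<lambda>x. mobius z1 x * g x) holomorphic_on ball 0 1"
    by (intro holomorphic_intros mobius_holomorphic_on z g)
  from holomorphic_on_compose_gen[OF this mobius_holomorphic_on[OF z(2)]]
  show "\<psi> holomorphic_on ball 0 1" using in1 by (simp add: \<psi>_def o_def image_subset_iff)
  show "cmod (\<psi> x) < 1" if "cmod x < 1" for x
    unfolding \<psi>_def by (rule mobius_norm_less_1[OF z(2) in1[OF that]])
  show "\<psi> p = 0" by (simp add: \<psi>_def gp)
  show "\<psi> 0 = q" using mobius_mobius[OF z(2) q] by (simp add: \<psi>_def g0)
  show "\<psi> z1 = z2" by (simp add: \<psi>_def)
qed (rule z)

text \<open>Here \<open>g\<close> has to take the values \<open>a\<close> at 0 and \<open>b\<close> at \<open>p\<close>. The map \<open>x \<mapsto> mobius a (\<rho> x)\<close> does so for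
\<open>\<rho> = mobius a b / p\<close>, and the last hypothesis is exactly \<open>|\<rho>| \<le> 1\<close>.\<close>
lemma green_le_region1_i:
  assumes p: "0 < p" "p < 1" and q: "0 < q" "q < 1" and z: "cmod z1 < 1" "cmod z2 < 1"
    and 1: "cmod z2 < cmod (mobius z1 (of_real p))" and 2: "cmod (mobius z2 (of_real q)) < cmod z1"
    and 3: "cmod (mobius (mobius z2 (of_real q) / z1) (z2 / mobius z1 (of_real p))) \<le> p"
  shows "green (z1, z2) (of_real p, 0) (0, of_real q) \<le> elog (cmod (z1 * mobius z1 (of_real p)))"
proof -
  define a b where "a = mobius z2 (of_real q) / z1" and "b = z2 / mobius z1 (of_real p)"
  define \<rho> where "\<rho> = mobius a b / of_real p"
  have nz: "z1 \<noteq> 0" "mobius z1 (of_real p) \<noteq> 0" using 1 2 by auto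
  have a: "cmod a < 1" and b: "cmod b < 1"
    unfolding a_def b_def norm_divide using 1 2 nz by (simp_all add: divide_less_eq)
  have \<rho>: "cmod \<rho> \<le> 1" using 3 p by (simp add: \<rho>_def a_def b_def norm_divide)
  have in1: "cmod (\<rho> * x) < 1" if "cmod x < 1" for x
    using norm_mult_less_1[OF that \<rho>] by (simp add: mult.commute)
  show ?thesis
  proof (rule mobius_disc_through[where g = "\<lambda>x. mobius a (\<rho> * x)"])
    have "(\<lambda>x. \<rho> * x) holomorphic_on ball 0 1" by (intro holomorphic_intros)
    from holomorphic_on_compose_gen[OF this mobius_holomorphic_on[OF a]]
    show "(\<lambda>x. mobius a (\<rho> * x)) holomorphic_on ball 0 1"
      using in1 by (simp add: o_def image_subset_iff)
    show "cmod (mobius a (\<rho> * x)) \<le> 1" if "cmod x < 1" for x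
      using mobius_norm_less_1[OF a in1[OF that]] by simp
    have "\<rho> * of_real p = mobius a b" using p by (simp add: \<rho>_def)
    thus "mobius z1 (of_real p) * mobius a (\<rho> * of_real p) = z2"
      using mobius_mobius[OF a b] nz by (simp add: b_def)
    show "z1 * mobius a (\<rho> * 0) = mobius z2 (of_real q)" using nz by (simp add: a_def)
  qed (use p q z in auto)
qed

section \<open>The Green function on Region 1\<close>
lemma green_swap_le:
  "green x P Q \<le> green (prod.swap x) (prod.swap P) (prod.swap Q)"
  unfolding green_def
proof (rule SUP_least, clarify)
  fix f assume f: "plurisubharmonic_on bidisk f" "\<forall>y\<in>bidisk. f y < 0" "log_pole f P" "log_pole f Q"
  have sw: "prod.swap y \<in> bidisk \<longleftrightarrow> y \<in> bidisk" for y by (cases y) (auto simp: bidisk_def)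
  have "plurisubharmonic_on bidisk (\<lambda>y. f (prod.swap y))"
    unfolding plurisubharmonic_on_def
  proof (intro conjI allI ballI)
    show "open bidisk" by (rule open_bidisk)
    show "f (prod.swap y) < \<infinity>" if "y \<in> bidisk" for y
      using f(1) sw[of y] that by (auto simp: plurisubharmonic_on_def)
    show "usc_on bidisk (\<lambda>y. f (prod.swap y))"
    proof (rule usc_on_compose[where g = prod.swap])
      show "usc_on bidisk f" using f(1) by (simp add: plurisubharmonic_on_def)
      show "continuous_on bidisk prod.swap" unfolding prod.swap_def by (intro continuous_intros)
      show "prod.swap ` bidisk \<subseteq> bidisk" using sw by blast
    qed
    fix a1 a2 b1 b2
    have "(a1 + l * b1, a2 + l * b2) \<in> bidisk \<longleftrightarrow> (a2 + l * b2, a1 + l * b1) \<in> bidisk" for l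
      using sw[of "(a1 + l * b1, a2 + l * b2)"] by simp
    thus "subharmonic_on {l. (a1 + l * b1, a2 + l * b2) \<in> bidisk}
            (\<lambda>l. f (prod.swap (a1 + l * b1, a2 + l * b2)))"
      using f(1) by (simp add: plurisubharmonic_on_def)
  qed
  moreover have "log_pole (\<lambda>y. f (prod.swap y)) (prod.swap a)" if "log_pole f a" for a
  proof -
    from that obtain C d where d: "d > 0"
      "\<And>y. y \<noteq> a \<Longrightarrow> dist y a < d \<Longrightarrow> f y \<le> ereal (ln (norm (y - a)) + C)"
      unfolding log_pole_def eventually_at by auto
    have eq: "norm (prod.swap y - a) = norm (y - prod.swap a)" for y
      by (cases y; cases a) (simp add: norm_Pair add.commute)
    have "f (prod.swap y) \<le> ereal (ln (norm (y - prod.swap a)) + C)"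
      if "y \<noteq> prod.swap a" "dist y (prod.swap a) < d" for y
    proof -
      have "prod.swap y \<noteq> a" using that(1) by (metis swap_swap)
      moreover have "dist (prod.swap y) a < d" using that(2) by (simp only: dist_norm eq)
      ultimately show ?thesis using d(2)[of "prod.swap y"] by (simp add: eq)
    qed
    thus ?thesis unfolding log_pole_def eventually_at using d(1) by (intro exI[of _ C] exI[of _ d]) blast
  qed
  moreover have "\<forall>y\<in>bidisk. f (prod.swap y) < 0" using f(2) sw by blast
  ultimately show "f x \<le> (SUP f \<in> {f. plurisubharmonic_on bidisk f \<and> (\<forall>y\<in>bidisk. f y < 0) \<and>
      log_pole f (prod.swap P) \<and> log_pole f (prod.swap Q)}. f (prod.swap x))"
    using f by (intro SUP_upper2[where i = "\<lambda>y. f (prod.swap y)"]) auto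
qed

lemma green_commute: "green x P Q = green x Q P"
  unfolding green_def by (simp only: conj_ac)

theorem mainTheorem3:
  fixes p q :: real and z1 z2 :: complex
  assumes "0 < p" "p < 1" "0 < q" "q < 1"
    and "(z1, z2) \<in> region1 p q"
  shows "green (z1, z2) (of_real p, 0) (0, of_real q) =
         elog (max (cmod (z1 * mobius z1 (of_real p))) (cmod (z2 * mobius z2 (of_real q))))"
proof (rule antisym)
  have z: "cmod z1 < 1" "cmod z2 < 1" using assms(5) by (auto simp: region1_def bidisk_def)
  consider
    (i) "cmod z2 < cmod (mobius z1 (of_real p))" "cmod (mobius z2 (of_real q)) < cmod z1"
       "cmod (mobius (mobius z2 (of_real q) / z1) (z2 / mobius z1 (of_real p))) \<le> p"
  | (ii) "cmod (mobius z1 (of_real p)) < cmod z2" "cmod z1 < cmod (mobius z2 (of_real q))"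
       "cmod (mobius (z1 / mobius z2 (of_real q)) (mobius z1 (of_real p) / z2)) \<le> q"
  | (iii) w where "cmod w = 1" "z2 = w * mobius z1 (of_real p)" "mobius z2 (of_real q) = w * z1"
    using assms(5) by (auto simp: region1_def)
  thus "green (z1, z2) (of_real p, 0) (0, of_real q) \<le>
         elog (max (cmod (z1 * mobius z1 (of_real p))) (cmod (z2 * mobius z2 (of_real q))))"
  proof cases
    case i
    from green_le_region1_i[OF assms(1-4) z i] show ?thesis
      by (rule order_trans) (intro elog_mono max.cobounded1)
  next
    case ii
    have "green (z1, z2) (of_real p, 0) (0, of_real q) \<le> green (z2, z1) (of_real q, 0) (0, of_real p)"
      using green_swap_le[of "(z1, z2)" "(of_real p, 0)" "(0, of_real q)"] by (simp add: green_commute)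
    also have "\<dots> \<le> elog (cmod (z2 * mobius z2 (of_real q)))"
      using assms(1-4) z ii by (intro green_le_region1_i) (simp_all add: cmod_mobius_commute)
    finally show ?thesis by (rule order_trans) (intro elog_mono max.cobounded2)
  next
    case iii
    have "green (z1, z2) (of_real p, 0) (0, of_real q) \<le> elog (cmod (z1 * mobius z1 (of_real p)))"
      by (rule mobius_disc_through[where g = "\<lambda>x. w"])
        (use z assms(1-4) iii in \<open>auto intro: holomorphic_intros simp: mult.commute\<close>)
    thus ?thesis by (rule order_trans) (intro elog_mono max.cobounded1)
  qed
  show "elog (max (cmod (z1 * mobius z1 (of_real p))) (cmod (z2 * mobius z2 (of_real q))))
      \<le> green (z1, z2) (of_real p, 0) (0, of_real q)"
    using green_ge[of p q "(z1, z2)"] assms(1-4) by (simp add: pole_modulus_def)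
qed

end
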